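(* Let $n\ge1$, let $\{1,\dots,n\}=I\sqcup J$ be a partition, let $\phi=\phi(p_i,x^j)$ ($i\in I$, $j\in J$) be a smooth function, and let the Legendre submanifold $\Sigma_\phi$ of the contact manifold $(P,\theta)$ be defined by the equations $$x^0=\phi-\sum_{i\in I}p_i\phi_i,\qquad p_j=-\phi_j\ (j\in J),\qquad x^i=\phi_i\ (i\in I).$$ Then, at the points where the restriction of the metric $G$ to $\Sigma_\phi$ is nondegenerate, the second fundamental form $II(X,Y)$ of the submanifold $\Sigma_\phi$ with respect to $G$ is given by $$II(Y_k,Y_l)=\sum_{s=1}^n\phi_{lks}Z_s\qquad(1\le k,l\le n),$$ where the vector fields $Y_k=V_k+\sum_{l=1}^n\phi_{kl}W_l$ form a basis of the tangent bundle of $\Sigma_\phi$, the vector fields $Z_k=W_k-\frac12\sum_{l=1}^n\phi^{kl}Y_l$ form a basis of the orthogonal bundle of $\Sigma_\phi$ in the distribution $D=\ker\theta$, and $\phi_{lks}=Y_k(\phi_{ls})$.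
   Context: $P=\mathbb{R}^{2n+1}$ has coordinates $(x^0;p_1,\dots,p_n;x^1,\dots,x^n)$ and contact form $\theta=dx^0+\sum_{i=1}^n p_i\,dx^i$. The Mrugala metric is $G=2\sum_{k=1}^n dp_k\odot dx^k+\theta\otimes\theta$, where $dp_k\odot dx^k=\frac12(dp_k\otimes dx^k+dx^k\otimes dp_k)$. A Legendre submanifold is an $n$-dimensional integral submanifold of $D=\ker\theta$. Frame: $P_k=\partial_{p_k}$, $X_k=\partial_{x^k}-p_k\partial_{x^0}$. Put $V_k=P_k$ and $W_k=X_k$ if $k\in I$; $V_k=X_k$ and $W_k=-P_k$ if $k\in J$. Subscripts on $\phi$ denote partial derivatives with respect to the arguments of $\phi$: $\phi_i=\partial_{p_i}\phi$ for $i\in I$, $\phi_j=\partial_{x^j}\phi$ for $j\in J$, and $\phi_{kl}$ is the full Hessian, $k,l\in\{1,\dots,n\}$. The restriction of $G$ to $\Sigma_\phi$ is $\sum_{i,i'\in I}2\phi_{ii'}dp_i\odot dp_{i'}-\sum_{j,j'\in J}2\phi_{jj'}dx^j\odot dx^{j'}$, so nondegeneracy means that the blocks $(\phi_{ii'})_{i,i'\in I}$ and $(\phi_{jj'})_{j,j'\in J}$ are invertible. The symbols $\phi^{ii'}$ and $\phi^{jj'}$ denote the entries of the inverses of these two blocks, and $\phi^{ij}=\phi^{ji}=0$ for $i\in I$, $j\in J$. The second fundamental form $II(X,Y)$ is the $G$-orthogonal projection of $\nabla_XY$ to the normal bundle of $\Sigma_\phi$, where $\nabla$ is the Levi-Civita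 connection of $G$ and $X,Y$ are tangent to $\Sigma_\phi$. *)

theory Defs
  imports "HOL-Analysis.Analysis"
begin

section \<open>Smooth maps and smooth fields on Euclidean spaces\<close>

text \<open>The condition \<open>C_upto S f k\<close> says that f is of class C^k on S; it is only meaningful for
  open S.\<close>

fun C_upto :: "'a::euclidean_space set \<Rightarrow> ('a \<Rightarrow> 'b::euclidean_space) \<Rightarrow> nat \<Rightarrow> bool" where
  "C_upto S f 0 \<longleftrightarrow> continuous_on S f"
| "C_upto S f (Suc k) \<longleftrightarrow>
     (\<forall>z\<in>S. f differentiable (at z)) \<and>
     (\<forall>v. C_upto S (\<lambda>z. frechet_derivative f (at z) v) k)"

definition smooth_on :: "'a::euclidean_space set \<Rightarrow> ('a \<Rightarrow> 'b::euclidean_space) \<Rightarrow> bool" where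
  "smooth_on S f \<longleftrightarrow> (\<forall>k. C_upto S f k)"

text \<open>Vector fields on (subsets of) a Euclidean space are functions into the same space.
  The derivative of a function along a vector field, and the Lie bracket:\<close>

definition deriv_along ::
  "('a::euclidean_space \<Rightarrow> 'a) \<Rightarrow> ('a \<Rightarrow> 'b::euclidean_space) \<Rightarrow> 'a \<Rightarrow> 'b" where
  "deriv_along X f z = frechet_derivative f (at z) (X z)"

definition lie_bracket :: "('a::euclidean_space \<Rightarrow> 'a) \<Rightarrow> ('a \<Rightarrow> 'a) \<Rightarrow> 'a \<Rightarrow> 'a" where
  "lie_bracket X Y z = deriv_along X Y z - deriv_along Y X z"

text \<open>A field along an arbitrary subset S is smooth if it extends smoothly to a neighbourhood
  of each point of S.\<close>

definition smooth_field_along :: "'a::euclidean_space set \<Rightarrow> ('a \<Rightarrow> 'a) \<Rightarrow> bool" where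
  "smooth_field_along S X \<longleftrightarrow>
     (\<forall>q\<in>S. \<exists>W X'. open W \<and> q \<in> W \<and> smooth_on W X' \<and> (\<forall>z\<in>W \<inter> S. X' z = X z))"

text \<open>The fields \<open>F k\<close> form a basis of the bundle with fibre \<open>E q\<close> over \<open>q \<in> S\<close>.\<close>

definition frame_on ::
  "'a::euclidean_space set \<Rightarrow> ('a \<Rightarrow> 'a set) \<Rightarrow> ('k \<Rightarrow> 'a \<Rightarrow> 'a) \<Rightarrow> bool" where
  "frame_on S E F \<longleftrightarrow>
     (\<forall>k. smooth_field_along S (F k)) \<and>
     (\<forall>q\<in>S. inj (\<lambda>k. F k q) \<and> independent (range (\<lambda>k. F k q)) \<and>
             span (range (\<lambda>k. F k q)) = E q)"


section \<open>Submanifolds, Levi-Civita connection, second fundamental form\<close>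

definition tangent_space :: "'a::euclidean_space set \<Rightarrow> 'a \<Rightarrow> 'a set" where
  "tangent_space S q = {v. \<exists>(c :: real \<Rightarrow> 'a) e. e > 0 \<and> smooth_on {-e<..<e} c \<and>
     c ` {-e<..<e} \<subseteq> S \<and> c 0 = q \<and> (c has_vector_derivative v) (at 0)}"

text \<open>Here and below, a (pseudo-)metric g assigns to each point a bilinear form on the tangent
  space at that point.\<close>

definition orthogonal_space ::
  "('a::euclidean_space \<Rightarrow> 'a \<Rightarrow> 'a \<Rightarrow> real) \<Rightarrow> 'a set \<Rightarrow> 'a \<Rightarrow> 'a set" where
  "orthogonal_space g S q = {v. \<forall>u\<in>tangent_space S q. g q u v = 0}"

definition nondegenerate_at ::
  "('a::euclidean_space \<Rightarrow> 'a \<Rightarrow> 'a \<Rightarrow> real) \<Rightarrow> 'a set \<Rightarrow> 'a \<Rightarrow> bool" where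
  "nondegenerate_at g S q \<longleftrightarrow>
     (\<forall>u\<in>tangent_space S q. (\<forall>v\<in>tangent_space S q. g q u v = 0) \<longrightarrow> u = 0)"

text \<open>The orthogonal projection onto the normal space; it is defined where the restriction of g
  to S is nondegenerate.\<close>

definition normal_projection ::
  "('a::euclidean_space \<Rightarrow> 'a \<Rightarrow> 'a \<Rightarrow> real) \<Rightarrow> 'a set \<Rightarrow> 'a \<Rightarrow> 'a \<Rightarrow> 'a" where
  "normal_projection g S q v =
     (THE w. w \<in> orthogonal_space g S q \<and> v - w \<in> tangent_space S q)"

text \<open>\<open>levi_civita_on W g D\<close>: on the open set W (the whole space or, to allow fields that are only
  defined locally, a smaller one), the operator D (where \<open>D X Y\<close> is the covariant
  derivative of Y along X) is an affine connection that is torsion-free and compatible with g.\<close>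

definition affine_connection_on ::
  "'a::euclidean_space set \<Rightarrow> (('a \<Rightarrow> 'a) \<Rightarrow> ('a \<Rightarrow> 'a) \<Rightarrow> 'a \<Rightarrow> 'a) \<Rightarrow> bool" where
  "affine_connection_on W D \<longleftrightarrow>
     (\<forall>X Y. smooth_on W X \<longrightarrow> smooth_on W Y \<longrightarrow> smooth_on W (D X Y)) \<and>
     (\<forall>X X' Y. smooth_on W X \<longrightarrow> smooth_on W X' \<longrightarrow> smooth_on W Y \<longrightarrow>
        (\<forall>z\<in>W. D (\<lambda>z. X z + X' z) Y z = D X Y z + D X' Y z)) \<and>
     (\<forall>f X Y. smooth_on W f \<longrightarrow> smooth_on W X \<longrightarrow> smooth_on W Y \<longrightarrow>
        (\<forall>z\<in>W. D (\<lambda>z. f z *\<^sub>R X z) Y z = f z *\<^sub>R D X Y z)) \<and>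
     (\<forall>X Y Y'. smooth_on W X \<longrightarrow> smooth_on W Y \<longrightarrow> smooth_on W Y' \<longrightarrow>
        (\<forall>z\<in>W. D X (\<lambda>z. Y z + Y' z) z = D X Y z + D X Y' z)) \<and>
     (\<forall>f X Y. smooth_on W f \<longrightarrow> smooth_on W X \<longrightarrow> smooth_on W Y \<longrightarrow>
        (\<forall>z\<in>W. D X (\<lambda>z. f z *\<^sub>R Y z) z = deriv_along X f z *\<^sub>R Y z + f z *\<^sub>R D X Y z))"

definition levi_civita_on ::
  "'a::euclidean_space set \<Rightarrow> ('a \<Rightarrow> 'a \<Rightarrow> 'a \<Rightarrow> real) \<Rightarrow>
   (('a \<Rightarrow> 'a) \<Rightarrow> ('a \<Rightarrow> 'a) \<Rightarrow> 'a \<Rightarrow> 'a) \<Rightarrow> bool" where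
  "levi_civita_on W g D \<longleftrightarrow>
     affine_connection_on W D \<and>
     (\<forall>X Y. smooth_on W X \<longrightarrow> smooth_on W Y \<longrightarrow>
        (\<forall>z\<in>W. D X Y z - D Y X z = lie_bracket X Y z)) \<and>
     (\<forall>X Y Z. smooth_on W X \<longrightarrow> smooth_on W Y \<longrightarrow> smooth_on W Z \<longrightarrow>
        (\<forall>z\<in>W. deriv_along X (\<lambda>z. g z (Y z) (Z z)) z = g z (D X Y z) (Z z) + g z (Y z) (D X Z z)))"

text \<open>The second fundamental form of S for the connection D. The arguments X and Y are fields on
  an open set of the ambient space that are tangent to S along S, i.e. fields on S together with
  an extension; the value depends only on the restrictions of X and Y to S.\<close>

definition second_fundamental_form ::
  "('a::euclidean_space \<Rightarrow> 'a \<Rightarrow> 'a \<Rightarrow> real) \<Rightarrow> 'a set \<Rightarrow>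
   (('a \<Rightarrow> 'a) \<Rightarrow> ('a \<Rightarrow> 'a) \<Rightarrow> 'a \<Rightarrow> 'a) \<Rightarrow> ('a \<Rightarrow> 'a) \<Rightarrow> ('a \<Rightarrow> 'a) \<Rightarrow> 'a \<Rightarrow> 'a" where
  "second_fundamental_form g S D X Y q = normal_projection g S q (D X Y q)"


section \<open>The contact phase space and the Mrugala metric\<close>

text \<open>Points, and also tangent vectors, are triples \<open>(x0, p, x)\<close>; the index type \<open>'n\<close> plays the
  role of {1,...,n}.\<close>

type_synonym 'n phase = "real \<times> (real ^ 'n) \<times> (real ^ 'n)"

definition p_of :: "'n::finite phase \<Rightarrow> real ^ 'n" where
  "p_of z = fst (snd z)"

definition x_of :: "'n::finite phase \<Rightarrow> real ^ 'n" where
  "x_of z = snd (snd z)"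

definition dx0 :: "'n::finite phase \<Rightarrow> real" where
  "dx0 v = fst v"

definition dp :: "'n::finite \<Rightarrow> 'n phase \<Rightarrow> real" where
  "dp k v = p_of v $ k"

definition dx :: "'n::finite \<Rightarrow> 'n phase \<Rightarrow> real" where
  "dx k v = x_of v $ k"

definition contact_form :: "'n::finite phase \<Rightarrow> 'n phase \<Rightarrow> real" where
  "contact_form z v = dx0 v + (\<Sum>k\<in>UNIV. p_of z $ k * dx k v)"

definition contact_dist :: "'n::finite phase \<Rightarrow> 'n phase set" where
  "contact_dist z = {v. contact_form z v = 0}"

definition sym_prod :: "('a \<Rightarrow> real) \<Rightarrow> ('a \<Rightarrow> real) \<Rightarrow> 'a \<Rightarrow> 'a \<Rightarrow> real" where
  "sym_prod \<alpha> \<beta> u v = (\<alpha> u * \<beta> v + \<beta> u * \<alpha> v) / 2"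

definition mrugala :: "'n::finite phase \<Rightarrow> 'n phase \<Rightarrow> 'n phase \<Rightarrow> real" where
  "mrugala z u v =
     2 * (\<Sum>k\<in>UNIV. sym_prod (dp k) (dx k) u v) + contact_form z u * contact_form z v"

text \<open>An n-dimensional embedded submanifold (local parametrisations by immersions that are
  homeomorphisms onto open pieces of S) that is an integral submanifold of the contact
  distribution.\<close>

definition legendre_submanifold :: "'n::finite phase set \<Rightarrow> bool" where
  "legendre_submanifold S \<longleftrightarrow>
     (\<forall>q\<in>S. \<exists>W (A :: (real ^ 'n) set) f h. open W \<and> q \<in> W \<and> open A \<and> smooth_on A f \<and>
        (\<forall>u\<in>A. inj (frechet_derivative f (at u))) \<and> homeomorphism A (S \<inter> W) f h) \<and>
     (\<forall>q\<in>S. tangent_space S q \<subseteq> contact_dist q)"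

definition P_field :: "'n::finite \<Rightarrow> 'n phase \<Rightarrow> 'n phase" where
  "P_field k z = (0, axis k 1, 0)"

definition X_field :: "'n::finite \<Rightarrow> 'n phase \<Rightarrow> 'n phase" where
  "X_field k z = (- (p_of z $ k), 0, axis k 1)"

definition V_field :: "'n::finite set \<Rightarrow> 'n \<Rightarrow> 'n phase \<Rightarrow> 'n phase" where
  "V_field I k z = (if k \<in> I then P_field k z else X_field k z)"

definition W_field :: "'n::finite set \<Rightarrow> 'n \<Rightarrow> 'n phase \<Rightarrow> 'n phase" where
  "W_field I k z = (if k \<in> I then X_field k z else - P_field k z)"


section \<open>The Legendre submanifold generated by a function\<close>

text \<open>In this section I and J are assumed to partition the index type. The generating function is a function of
  a vector u in R^n with \<open>u $ i = p_i\<close> for i in I and \<open>u $ j = x^j\<close> for j in J; the map \<open>args I\<close>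
  extracts this vector from a point of the phase space.\<close>

definition args :: "'n::finite set \<Rightarrow> 'n phase \<Rightarrow> real ^ 'n" where
  "args I z = (\<chi> k. if k \<in> I then p_of z $ k else x_of z $ k)"

definition partial :: "(real ^ 'n::finite \<Rightarrow> real) \<Rightarrow> 'n \<Rightarrow> real ^ 'n \<Rightarrow> real" where
  "partial \<phi> k u = frechet_derivative \<phi> (at u) (axis k 1)"

definition hessian :: "(real ^ 'n::finite \<Rightarrow> real) \<Rightarrow> real ^ 'n \<Rightarrow> real ^ 'n ^ 'n" where
  "hessian \<phi> u = (\<chi> k l. partial (partial \<phi> k) l u)"

definition legendre_graph ::
  "'n::finite set \<Rightarrow> 'n set \<Rightarrow> (real ^ 'n) set \<Rightarrow> (real ^ 'n \<Rightarrow> real) \<Rightarrow> 'n phase set" where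
  "legendre_graph I J U \<phi> = {z. args I z \<in> U \<and>
     fst z = \<phi> (args I z) - (\<Sum>i\<in>I. p_of z $ i * partial \<phi> i (args I z)) \<and>
     (\<forall>j\<in>J. p_of z $ j = - partial \<phi> j (args I z)) \<and>
     (\<forall>i\<in>I. x_of z $ i = partial \<phi> i (args I z))}"

text \<open>The inverse of the block \<open>(H$k$l)\<close> with k and l in A, extended by zero.\<close>

definition block_inverse :: "'n::finite set \<Rightarrow> real ^ 'n ^ 'n \<Rightarrow> real ^ 'n ^ 'n" where
  "block_inverse A H = (THE B.
     (\<forall>k l. k \<notin> A \<or> l \<notin> A \<longrightarrow> B $ k $ l = 0) \<and>
     (\<forall>k\<in>A. \<forall>l\<in>A. (\<Sum>m\<in>A. H $ k $ m * B $ m $ l) = (if k = l then 1 else 0)) \<and>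
     (\<forall>k\<in>A. \<forall>l\<in>A. (\<Sum>m\<in>A. B $ k $ m * H $ m $ l) = (if k = l then 1 else 0)))"

definition phi_inv ::
  "'n::finite set \<Rightarrow> 'n set \<Rightarrow> (real ^ 'n \<Rightarrow> real) \<Rightarrow> 'n \<Rightarrow> 'n \<Rightarrow> 'n phase \<Rightarrow> real" where
  "phi_inv I J \<phi> k l z =
     (if k \<in> I \<and> l \<in> I then block_inverse I (hessian \<phi> (args I z)) $ k $ l
      else if k \<in> J \<and> l \<in> J then block_inverse J (hessian \<phi> (args I z)) $ k $ l
      else 0)"

text \<open>Since \<open>phi\<close> and its derivatives are functions of coordinates of the phase space, the fields
  below are defined for all z with \<open>args I z\<close> in the domain of \<open>phi\<close>, not only along the
  submanifold.\<close>

definition Y_field ::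
  "'n::finite set \<Rightarrow> (real ^ 'n \<Rightarrow> real) \<Rightarrow> 'n \<Rightarrow> 'n phase \<Rightarrow> 'n phase" where
  "Y_field I \<phi> k z =
     V_field I k z + (\<Sum>l\<in>UNIV. hessian \<phi> (args I z) $ k $ l *\<^sub>R W_field I l z)"

definition Z_field ::
  "'n::finite set \<Rightarrow> 'n set \<Rightarrow> (real ^ 'n \<Rightarrow> real) \<Rightarrow> 'n \<Rightarrow> 'n phase \<Rightarrow> 'n phase" where
  "Z_field I J \<phi> k z =
     W_field I k z - (1 / 2) *\<^sub>R (\<Sum>l\<in>UNIV. phi_inv I J \<phi> k l z *\<^sub>R Y_field I \<phi> l z)"

definition phi3 ::
  "'n::finite set \<Rightarrow> (real ^ 'n \<Rightarrow> real) \<Rightarrow> 'n \<Rightarrow> 'n \<Rightarrow> 'n \<Rightarrow> 'n phase \<Rightarrow> real" where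
  "phi3 I \<phi> l k s z = deriv_along (Y_field I \<phi> k) (\<lambda>z. hessian \<phi> (args I z) $ l $ s) z"

end

theory Submission
  imports Defs
begin

text \<open>
  Along the graph, the signed half of the coordinates complementary to the arguments u is the gradient
  of \<open>\<phi>\<close>, and the contact form vanishes on the fields V and W; so the derivative of the parametrisation
  in direction k is \<open>Y_k\<close>, by symmetry of the Hessian. In the frame V, W the metric on ker theta is the
  hyperbolic form \<open>G(V_k, W_l) = \<plusminus> \<delta>_kl\<close>, which reduces nondegeneracy and the orthogonality of the
  \<open>Z_k\<close> to linear algebra of the two diagonal blocks of the Hessian.

  Koszul's formula with a constant third field gives, for fields X, Y that lie in ker theta at a point,
  \<open>\<nabla>_X Y = DY(X) + (b(X,Y) + b(Y,X))/2 \<partial>/\<partial>x0\<close> with \<open>b = \<Sum>_k dp_k \<otimes> dx^k\<close>. Differentiating the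
  identity \<open>\<theta>(Y_l) = 0\<close> along \<open>Y_k\<close> shows \<open>\<theta>(DY_l(Y_k)) = - b(Y_k,Y_l)\<close>, and b is symmetric on the
  tangent spaces. Hence \<open>\<nabla>_{Y_k} Y_l\<close> equals \<open>\<Sum>_s \<phi>_lks W_s\<close> exactly, and each \<open>W_s\<close> differs from
  \<open>Z_s\<close> by a tangent vector.
\<close>

section \<open>Calculus of smooth maps\<close>

lemma has_derivative_frechet:
  "f differentiable (at z) \<Longrightarrow> (f has_derivative frechet_derivative f (at z)) (at z)"
  by (simp add: frechet_derivative_works)

lemma frechet_derivative_eqI:
  "(f has_derivative D) (at z) \<Longrightarrow> frechet_derivative f (at z) = D"
  by (metis frechet_derivative_at)

text \<open>On an open set a derivative depends only on the values on that set, so equality on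
  \<open>S\<close> passes to all iterated derivatives.\<close>

lemma C_upto_cong:
  assumes "open S" "\<And>z. z \<in> S \<Longrightarrow> f z = g z"
  shows "C_upto S f k \<longleftrightarrow> C_upto S g k"
  using assms(2)
proof (induction k arbitrary: f g)
  case 0
  then show ?case by (simp cong: continuous_on_cong)
next
  case (Suc k)
  have d: "(f has_derivative D) (at z) \<longleftrightarrow> (g has_derivative D) (at z)" if "z \<in> S" for z D
    using has_derivative_transform_within_open[OF _ assms(1) that] Suc.prems by metis
  have "f differentiable (at z) \<longleftrightarrow> g differentiable (at z)" if "z \<in> S" for z
    using d[OF that] by (simp add: differentiable_def)
  moreover have "frechet_derivative f (at z) = frechet_derivative g (at z)" if "z \<in> S" for z
    using d[OF that] by (simp add: frechet_derivative_def)
  ultimately show ?case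
    using Suc.IH[of "\<lambda>z. frechet_derivative f (at z) _" "\<lambda>z. frechet_derivative g (at z) _"]
    by simp
qed

lemma smooth_on_cong:
  assumes "open S" "\<And>z. z \<in> S \<Longrightarrow> f z = g z"
  shows "smooth_on S f \<longleftrightarrow> smooth_on S g"
  using C_upto_cong[OF assms] by (simp add: smooth_on_def)

lemma C_upto_SucD: "C_upto S f (Suc k) \<Longrightarrow> C_upto S f k"
proof (induction k arbitrary: f)
  case 0
  then show ?case
    by (simp add: continuous_at_imp_continuous_on differentiable_imp_continuous_within)
next
  case (Suc k)
  then show ?case by (metis C_upto.simps(2))
qed

lemma smooth_on_differentiable: "smooth_on S f \<Longrightarrow> z \<in> S \<Longrightarrow> f differentiable (at z)"
  unfolding smooth_on_def by (metis C_upto.simps(2))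

lemma smooth_on_has_derivative:
  "smooth_on S f \<Longrightarrow> z \<in> S \<Longrightarrow> (f has_derivative frechet_derivative f (at z)) (at z)"
  by (simp add: has_derivative_frechet smooth_on_differentiable)

lemma smooth_on_directional:
  "smooth_on S f \<Longrightarrow> smooth_on S (\<lambda>z. frechet_derivative f (at z) v)"
  unfolding smooth_on_def by (metis C_upto.simps(2))

lemma smooth_on_continuous_on: "smooth_on S f \<Longrightarrow> continuous_on S f"
  unfolding smooth_on_def by (metis C_upto.simps(1))

lemma C_upto_const: "C_upto S (\<lambda>z. c) k"
  by (induction k arbitrary: c) auto

lemma smooth_on_const [simp]: "smooth_on S (\<lambda>z. c)"
  by (simp add: smooth_on_def C_upto_const)

lemma smooth_on_linear:
  assumes "bounded_linear L"
  shows "smooth_on S L"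
  unfolding smooth_on_def
proof
  fix k
  have "frechet_derivative L (at z) = L" for z
    using frechet_derivative_eqI[OF bounded_linear_imp_has_derivative[OF assms]] .
  then show "C_upto S L k"
    using assms by (cases k)
      (auto simp: C_upto_const linear_continuous_on intro: bounded_linear_imp_differentiable)
qed

lemma C_upto_add:
  assumes "open S"
  shows "C_upto S f k \<Longrightarrow> C_upto S g k \<Longrightarrow> C_upto S (\<lambda>z. f z + g z) k"
proof (induction k arbitrary: f g)
  case 0
  then show ?case by (simp add: continuous_on_add)
next
  case (Suc k)
  have "frechet_derivative (\<lambda>z. f z + g z) (at z) =
      (\<lambda>v. frechet_derivative f (at z) v + frechet_derivative g (at z) v)" if "z \<in> S" for z
    using Suc.prems that
    by (intro frechet_derivative_eqI has_derivative_add has_derivative_frechet) auto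
  then have "C_upto S (\<lambda>z. frechet_derivative (\<lambda>z. f z + g z) (at z) v) k" for v
    using Suc by (subst C_upto_cong[OF assms]) auto
  then show ?case using Suc.prems by auto
qed

text \<open>The product rule gives two terms of the same bilinear shape, each pairing a derivative
  of class C^k with a function lowered to C^k by \<open>C_upto_SucD\<close>; hence the induction is
  over all \<open>f\<close> and \<open>g\<close>.\<close>

lemma C_upto_bilinear:
  assumes "bounded_bilinear B" "open S"
  shows "C_upto S f k \<Longrightarrow> C_upto S g k \<Longrightarrow> C_upto S (\<lambda>z. B (f z) (g z)) k"
proof (induction k arbitrary: f g)
  case 0
  then show ?case by (simp add: bounded_bilinear.continuous_on[OF assms(1)])
next
  case (Suc k)
  have D: "((\<lambda>z. B (f z) (g z)) has_derivative
      (\<lambda>v. B (f z) (frechet_derivative g (at z) v) + B (frechet_derivative f (at z) v) (g z)))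
      (at z)" if "z \<in> S" for z
    using Suc.prems that
    by (intro bounded_bilinear.FDERIV[OF assms(1)] has_derivative_frechet) auto
  have "C_upto S (\<lambda>z. B (f z) (frechet_derivative g (at z) v) +
      B (frechet_derivative f (at z) v) (g z)) k" for v
    using Suc.prems C_upto_SucD[OF Suc.prems(1)] C_upto_SucD[OF Suc.prems(2)]
    by (intro C_upto_add[OF assms(2)] Suc.IH) simp_all
  then have "C_upto S (\<lambda>z. frechet_derivative (\<lambda>z. B (f z) (g z)) (at z) v) k" for v
    by (subst C_upto_cong[OF assms(2)]) (auto simp: frechet_derivative_eqI[OF D])
  moreover have "(\<lambda>z. B (f z) (g z)) differentiable (at z)" if "z \<in> S" for z
    using D[OF that] by (rule differentiableI)
  ultimately show ?case by simp
qed

lemma smooth_on_add: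
  "open S \<Longrightarrow> smooth_on S f \<Longrightarrow> smooth_on S g \<Longrightarrow> smooth_on S (\<lambda>z. f z + g z)"
  by (simp add: smooth_on_def C_upto_add)

lemma smooth_on_bilinear:
  "bounded_bilinear B \<Longrightarrow> open S \<Longrightarrow> smooth_on S f \<Longrightarrow> smooth_on S g \<Longrightarrow>
    smooth_on S (\<lambda>z. B (f z) (g z))"
  unfolding smooth_on_def by (blast intro: C_upto_bilinear)

lemmas smooth_on_scaleR = smooth_on_bilinear[OF bounded_bilinear_scaleR]

lemma smooth_on_mult:
  fixes f g :: "'a::euclidean_space \<Rightarrow> real"
  shows "open S \<Longrightarrow> smooth_on S f \<Longrightarrow> smooth_on S g \<Longrightarrow> smooth_on S (\<lambda>z. f z * g z)"
  by (rule smooth_on_bilinear[OF bounded_bilinear_mult])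

lemma smooth_on_minus:
  "open S \<Longrightarrow> smooth_on S f \<Longrightarrow> smooth_on S (\<lambda>z. - f z)"
  using smooth_on_scaleR[of S "\<lambda>_. - 1" f] by simp

lemma smooth_on_diff:
  "open S \<Longrightarrow> smooth_on S f \<Longrightarrow> smooth_on S g \<Longrightarrow> smooth_on S (\<lambda>z. f z - g z)"
  using smooth_on_add[of S f "\<lambda>z. - g z"] smooth_on_minus[of S g] by simp

lemma smooth_on_sum:
  "open S \<Longrightarrow> (\<And>a. a \<in> A \<Longrightarrow> smooth_on S (f a)) \<Longrightarrow> smooth_on S (\<lambda>z. \<Sum>a\<in>A. f a z)"
  by (induction A rule: infinite_finite_induct) (auto intro: smooth_on_add)

lemma smooth_on_prod:
  fixes f :: "'b \<Rightarrow> 'a::euclidean_space \<Rightarrow> real"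
  shows "open S \<Longrightarrow> (\<And>a. a \<in> A \<Longrightarrow> smooth_on S (f a)) \<Longrightarrow> smooth_on S (\<lambda>z. \<Prod>a\<in>A. f a z)"
  by (induction A rule: infinite_finite_induct) (auto intro: smooth_on_mult)

text \<open>The derivative of 1/f is -(1/f) f' (1/f), so smoothness bootstraps: if 1/f is C^k, so is
  its derivative.\<close>

lemma smooth_on_inverse:
  fixes f :: "'a::euclidean_space \<Rightarrow> real"
  assumes S: "open S" and f: "smooth_on S f" and nz: "\<And>z. z \<in> S \<Longrightarrow> f z \<noteq> 0"
  shows "smooth_on S (\<lambda>z. inverse (f z))"
  unfolding smooth_on_def
proof
  fix k
  show "C_upto S (\<lambda>z. inverse (f z)) k"
  proof (induction k)
    case 0
    then show ?case
      using smooth_on_continuous_on[OF f] nz by (simp add: continuous_on_inverse)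
  next
    case (Suc k)
    have D: "((\<lambda>z. inverse (f z)) has_derivative
        (\<lambda>v. - (inverse (f z) * frechet_derivative f (at z) v * inverse (f z)))) (at z)"
      if "z \<in> S" for z
      using Deriv.has_derivative_inverse[OF nz[OF that] smooth_on_has_derivative[OF f that]]
      by simp
    have "C_upto S (\<lambda>z. - 1 * (inverse (f z) * frechet_derivative f (at z) v * inverse (f z))) k" for v
      using Suc smooth_on_directional[OF f]
      by (intro C_upto_bilinear[OF bounded_bilinear_mult S] C_upto_const) (auto simp: smooth_on_def)
    then have "C_upto S (\<lambda>z. frechet_derivative (\<lambda>z. inverse (f z)) (at z) v) k" for v
      by (subst C_upto_cong[OF S]) (auto simp: frechet_derivative_eqI[OF D])
    moreover have "(\<lambda>z. inverse (f z)) differentiable (at z)" if "z \<in> S" for z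
      using D[OF that] by (rule differentiableI)
    ultimately show ?case by simp
  qed
qed

text \<open>For an affine inner map, the derivative along \<open>v\<close> is a directional
  derivative of \<open>f\<close> in the fixed direction \<open>L v\<close>, composed with the same
  map, so the induction closes at once. This covers composition with \<open>args I\<close> and with
  straight lines in the domain of \<phi>.\<close>

lemma C_upto_compose_affine:
  assumes L: "bounded_linear L" and S: "open S"
  shows "C_upto T f k \<Longrightarrow> (\<And>z. z \<in> S \<Longrightarrow> a + L z \<in> T) \<Longrightarrow> C_upto S (\<lambda>z. f (a + L z)) k"
proof (induction k arbitrary: f)
  case 0
  have "continuous_on S (\<lambda>z. a + L z)"
    using L by (intro continuous_intros linear_continuous_on)
  with 0 show ?case by (auto intro: continuous_on_compose2)
next
  case (Suc k)
  have D: "((\<lambda>z. f (a + L z)) has_derivative (\<lambda>v. frechet_derivative f (at (a + L z)) (L v))) (at z)"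
    if "z \<in> S" for z
  proof -
    have "((\<lambda>z. a + L z) has_derivative L) (at z)"
      using has_derivative_add[OF has_derivative_const bounded_linear_imp_has_derivative[OF L]]
      by simp
    moreover have "f differentiable (at (a + L z))"
      using Suc.prems that by simp
    ultimately show ?thesis
      by (rule has_derivative_compose[OF _ has_derivative_frechet])
  qed
  have "C_upto S (\<lambda>z. frechet_derivative f (at (a + L z)) (L v)) k" for v
    using Suc.prems by (intro Suc.IH) simp_all
  then have "C_upto S (\<lambda>z. frechet_derivative (\<lambda>z. f (a + L z)) (at z) v) k" for v
    by (subst C_upto_cong[OF S]) (auto simp: frechet_derivative_eqI[OF D])
  moreover have "(\<lambda>z. f (a + L z)) differentiable (at z)" if "z \<in> S" for z
    using D[OF that] by (rule differentiableI)
  ultimately show ?case by simp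
qed

lemma smooth_on_compose_affine:
  assumes "bounded_linear L" "open S" "smooth_on T f" "\<And>z. z \<in> S \<Longrightarrow> a + L z \<in> T"
  shows "smooth_on S (\<lambda>z. f (a + L z))"
  using assms unfolding smooth_on_def by (blast intro: C_upto_compose_affine)

lemma smooth_on_det:
  fixes A :: "'a::euclidean_space \<Rightarrow> real ^ 'n ^ 'n"
  assumes "open S" "\<And>i j. smooth_on S (\<lambda>z. A z $ i $ j)"
  shows "smooth_on S (\<lambda>z. det (A z))"
  unfolding det_def using assms by (intro smooth_on_sum smooth_on_mult smooth_on_prod) auto

text \<open>Schwarz's theorem, used for the symmetry of the Hessian. One mixed derivative at some
  point equals the other at another point, both in an arbitrarily small parallelogram, and
  continuity carries the equality to \<open>x\<close>.\<close>

lemma directional_derivatives_commute: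
  fixes f :: "'a::euclidean_space \<Rightarrow> real"
  assumes S: "open S" and f: "smooth_on S f" and x: "x \<in> S"
  shows "frechet_derivative (\<lambda>y. frechet_derivative f (at y) v) (at x) w =
         frechet_derivative (\<lambda>y. frechet_derivative f (at y) w) (at x) v"
proof -
  define D where "D v w = (\<lambda>x. frechet_derivative (\<lambda>y. frechet_derivative f (at y) v) (at x) w)" for v w
  have contD: "continuous_on S (D v w)" for v w
    unfolding D_def by (intro smooth_on_continuous_on smooth_on_directional f)
  text \<open>The mean value theorem, applied twice, turns the second difference of \<open>f\<close> into \<open>h\<^sup>2\<close> times a
    mixed derivative at a nearby point. The second difference is symmetric in v and w.\<close>
  have second_difference: "\<exists>s t. 0 < s \<and> s < h \<and> 0 < t \<and> t < h \<and>
      f (x + h *\<^sub>R v + h *\<^sub>R w) - f (x + h *\<^sub>R v) - f (x + h *\<^sub>R w) + f x =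
      h * h * D v w (x + s *\<^sub>R v + t *\<^sub>R w)"
    if h: "0 < h" and sub: "\<And>s t. 0 \<le> s \<Longrightarrow> s \<le> h \<Longrightarrow> 0 \<le> t \<Longrightarrow> t \<le> h \<Longrightarrow> x + s *\<^sub>R v + t *\<^sub>R w \<in> S"
    for h v w
  proof -
    have df: "((\<lambda>s. f (x + s *\<^sub>R v + t *\<^sub>R w)) has_real_derivative
        frechet_derivative f (at (x + s *\<^sub>R v + t *\<^sub>R w)) v) (at s)"
      if "0 \<le> s" "s \<le> h" "0 \<le> t" "t \<le> h" for s t
    proof -
      note F = smooth_on_has_derivative[OF f sub[OF that]]
      have "((\<lambda>s. x + s *\<^sub>R v + t *\<^sub>R w) has_derivative (\<lambda>r. r *\<^sub>R v)) (at s)"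
        by (auto intro!: derivative_eq_intros)
      from has_derivative_compose[OF this F] show ?thesis
        by (simp add: has_field_derivative_def linear_simps(5)[OF has_derivative_bounded_linear[OF F]]
            mult_commute_abs)
    qed
    have dfv: "((\<lambda>t. frechet_derivative f (at (x + s *\<^sub>R v + t *\<^sub>R w)) v) has_real_derivative
        D v w (x + s *\<^sub>R v + t *\<^sub>R w)) (at t)"
      if "0 \<le> s" "s \<le> h" "0 \<le> t" "t \<le> h" for s t
    proof -
      note F = smooth_on_has_derivative[OF smooth_on_directional[OF f, of v] sub[OF that]]
      have "((\<lambda>t. x + s *\<^sub>R v + t *\<^sub>R w) has_derivative (\<lambda>r. r *\<^sub>R w)) (at t)"
        by (auto intro!: derivative_eq_intros)
      from has_derivative_compose[OF this F] show ?thesis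
        by (simp add: has_field_derivative_def linear_simps(5)[OF has_derivative_bounded_linear[OF F]]
            mult_commute_abs D_def)
    qed
    \<comment> \<open>The zero multiples are left in place so that every point has the shape
      \<open>x + s *\<^sub>R v + t *\<^sub>R w\<close> to which \<open>df\<close> and
      \<open>dfv\<close> apply.\<close>
    obtain s where s: "0 < s" "s < h" and
      eq1: "(f (x + h *\<^sub>R v + h *\<^sub>R w) - f (x + h *\<^sub>R v + 0 *\<^sub>R w)) -
        (f (x + 0 *\<^sub>R v + h *\<^sub>R w) - f (x + 0 *\<^sub>R v + 0 *\<^sub>R w)) =
        (h - 0) * (frechet_derivative f (at (x + s *\<^sub>R v + h *\<^sub>R w)) v -
          frechet_derivative f (at (x + s *\<^sub>R v + 0 *\<^sub>R w)) v)"
    proof -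
      have "((\<lambda>s. f (x + s *\<^sub>R v + h *\<^sub>R w) - f (x + s *\<^sub>R v + 0 *\<^sub>R w)) has_real_derivative
          frechet_derivative f (at (x + s *\<^sub>R v + h *\<^sub>R w)) v -
          frechet_derivative f (at (x + s *\<^sub>R v + 0 *\<^sub>R w)) v) (at s)"
        if "0 \<le> s" "s \<le> h" for s
        using h by (intro DERIV_diff df that) auto
      from MVT2[OF h this] show thesis using that by blast
    qed
    obtain t where t: "0 < t" "t < h" and
      eq2: "frechet_derivative f (at (x + s *\<^sub>R v + h *\<^sub>R w)) v -
          frechet_derivative f (at (x + s *\<^sub>R v + 0 *\<^sub>R w)) v =
          (h - 0) * D v w (x + s *\<^sub>R v + t *\<^sub>R w)"
      using MVT2[OF h dfv[of s]] s by auto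
    show ?thesis
      using s t eq1 eq2 by (intro exI[of _ s] exI[of _ t]) (simp add: algebra_simps)
  qed
  have small: "\<exists>h>0. \<forall>s t. 0 \<le> s \<and> s \<le> h \<and> 0 \<le> t \<and> t \<le> h \<longrightarrow> x + s *\<^sub>R v + t *\<^sub>R w \<in> ball x d"
    if d: "0 < d" for d
  proof -
    \<comment> \<open>The summand 1 keeps the denominator positive for \<open>v = w = 0\<close> and
      makes the distance estimate strict.\<close>
    define h where "h = d / (norm v + norm w + 1)"
    have N: "0 < norm v + norm w + 1" by (simp add: add_nonneg_pos)
    then have "0 < h" using d by (simp add: h_def)
    moreover have "x + s *\<^sub>R v + t *\<^sub>R w \<in> ball x d"
      if st: "0 \<le> s" "s \<le> h" "0 \<le> t" "t \<le> h" for s t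
    proof -
      have "dist x (x + s *\<^sub>R v + t *\<^sub>R w) = norm (s *\<^sub>R v + t *\<^sub>R w)"
        unfolding dist_norm by (metis add.assoc add_diff_cancel_left' norm_minus_commute)
      also have "\<dots> \<le> s * norm v + t * norm w"
        using st norm_triangle_ineq[of "s *\<^sub>R v" "t *\<^sub>R w"] by simp
      also have "\<dots> \<le> h * norm v + h * norm w"
        using st by (intro add_mono mult_right_mono) auto
      also have "\<dots> < h * (norm v + norm w + 1)"
        using \<open>0 < h\<close> by (simp add: algebra_simps)
      also have "\<dots> = d" using N by (simp add: h_def)
      finally show ?thesis by simp
    qed
    ultimately show ?thesis by blast
  qed
  have "\<bar>D v w x - D w v x\<bar> \<le> e" if e: "0 < e" for e
  proof -
    have "\<exists>d>0. ball x d \<subseteq> S \<and> (\<forall>y\<in>ball x d. \<bar>D a b y - D a b x\<bar> < e / 2)" for a b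
    proof -
      have "isCont (D a b) x"
        using contD S x continuous_on_eq_continuous_at by blast
      then obtain d1 where "d1 > 0" "\<And>y. dist x y < d1 \<Longrightarrow> \<bar>D a b y - D a b x\<bar> < e / 2"
        using e unfolding continuous_at_eps_delta dist_real_def dist_commute[of _ x]
        by (meson half_gt_zero)
      moreover obtain d2 where "d2 > 0" "ball x d2 \<subseteq> S"
        using S x open_contains_ball by blast
      ultimately show ?thesis
        by (intro exI[of _ "min d1 d2"]) auto
    qed
    from this[of v w] this[of w v] obtain d1 d2 where d: "d1 > 0" "d2 > 0" "ball x d1 \<subseteq> S"
      and d1: "\<forall>y\<in>ball x d1. \<bar>D v w y - D v w x\<bar> < e / 2"
      and d2: "\<forall>y\<in>ball x d2. \<bar>D w v y - D w v x\<bar> < e / 2"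
      by (elim exE conjE)
    obtain h where h: "h > 0" and
      hb: "\<And>s t. 0 \<le> s \<Longrightarrow> s \<le> h \<Longrightarrow> 0 \<le> t \<Longrightarrow> t \<le> h \<Longrightarrow> x + s *\<^sub>R v + t *\<^sub>R w \<in> ball x (min d1 d2)"
      using small[of "min d1 d2"] d by auto
    have hb': "x + s *\<^sub>R w + t *\<^sub>R v \<in> ball x (min d1 d2)"
      if "0 \<le> s" "s \<le> h" "0 \<le> t" "t \<le> h" for s t
      using hb[OF that(3,4,1,2)] by (simp add: add_ac)
    obtain s t where st: "0 < s" "s < h" "0 < t" "t < h" and
      1: "f (x + h *\<^sub>R v + h *\<^sub>R w) - f (x + h *\<^sub>R v) - f (x + h *\<^sub>R w) + f x =
        h * h * D v w (x + s *\<^sub>R v + t *\<^sub>R w)"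
    proof -
      have "x + s *\<^sub>R v + t *\<^sub>R w \<in> S" if "0 \<le> s" "s \<le> h" "0 \<le> t" "t \<le> h" for s t
        using hb[OF that] d(3) by auto
      from second_difference[OF h this] show thesis using that by blast
    qed
    obtain s' t' where st': "0 < s'" "s' < h" "0 < t'" "t' < h" and
      2: "f (x + h *\<^sub>R w + h *\<^sub>R v) - f (x + h *\<^sub>R w) - f (x + h *\<^sub>R v) + f x =
        h * h * D w v (x + s' *\<^sub>R w + t' *\<^sub>R v)"
    proof -
      have "x + s *\<^sub>R w + t *\<^sub>R v \<in> S" if "0 \<le> s" "s \<le> h" "0 \<le> t" "t \<le> h" for s t
        using hb'[OF that] d(3) by auto
      from second_difference[OF h this] show thesis using that by blast
    qed
    have "h * h * D v w (x + s *\<^sub>R v + t *\<^sub>R w) = h * h * D w v (x + s' *\<^sub>R w + t' *\<^sub>R v)"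
    proof -
      have "x + h *\<^sub>R w + h *\<^sub>R v = x + h *\<^sub>R v + h *\<^sub>R w" by simp
      with 1 2 show ?thesis by (simp only:)
    qed
    then have "D v w (x + s *\<^sub>R v + t *\<^sub>R w) = D w v (x + s' *\<^sub>R w + t' *\<^sub>R v)"
      using h by simp
    moreover have "\<bar>D v w (x + s *\<^sub>R v + t *\<^sub>R w) - D v w x\<bar> < e / 2"
    proof -
      have "x + s *\<^sub>R v + t *\<^sub>R w \<in> ball x d1"
        using hb[of s t] st subset_ball[of "min d1 d2" d1 x] by (meson less_imp_le min.cobounded1 subsetD)
      then show ?thesis using d1 by blast
    qed
    moreover have "\<bar>D w v (x + s' *\<^sub>R w + t' *\<^sub>R v) - D w v x\<bar> < e / 2"
    proof -
      have "x + s' *\<^sub>R w + t' *\<^sub>R v \<in> ball x d2"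
        using hb'[of s' t'] st' subset_ball[of "min d1 d2" d2 x] by (meson less_imp_le min.cobounded2 subsetD)
      then show ?thesis using d2 by blast
    qed
    ultimately show ?thesis by linarith
  qed
  then have "\<bar>D v w x - D w v x\<bar> \<le> 0"
    using field_le_epsilon[of "\<bar>D v w x - D w v x\<bar>" 0] by (metis add_0)
  then show ?thesis by (simp add: D_def)
qed

section \<open>Frames\<close>

lemma sum_axis_scaleR: "(\<Sum>k\<in>UNIV. a $ k *\<^sub>R axis k 1) = (a :: real ^ 'n::finite)"
  by (simp add: vec_eq_iff axis_def if_distrib[of "\<lambda>x. _ * x"] cong: if_cong)

lemma span_range_eq:
  fixes F :: "'n::finite \<Rightarrow> 'a::real_vector"
  shows "span (range F) = range (\<lambda>a::real ^ 'n. \<Sum>k\<in>UNIV. a $ k *\<^sub>R F k)"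
proof
  show "span (range F) \<subseteq> range (\<lambda>a::real ^ 'n. \<Sum>k\<in>UNIV. a $ k *\<^sub>R F k)"
  proof (rule span_minimal)
    show "range F \<subseteq> range (\<lambda>a::real ^ 'n. \<Sum>k\<in>UNIV. a $ k *\<^sub>R F k)"
    proof safe
      fix k
      have "F k = (\<Sum>l\<in>UNIV. (axis k 1 :: real ^ 'n) $ l *\<^sub>R F l)"
        by (simp add: axis_def if_distrib[of "\<lambda>x. x *\<^sub>R _"] cong: if_cong)
      then show "F k \<in> range (\<lambda>a::real ^ 'n. \<Sum>k\<in>UNIV. a $ k *\<^sub>R F k)" by blast
    qed
    have "linear (\<lambda>a::real ^ 'n. \<Sum>k\<in>UNIV. a $ k *\<^sub>R F k)"
      by (intro linearI) (simp_all add: scaleR_left_distrib sum.distrib scaleR_sum_right)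
    then show "subspace (range (\<lambda>a::real ^ 'n. \<Sum>k\<in>UNIV. a $ k *\<^sub>R F k))"
      by (simp add: linear_subspace_image)
  qed
  show "range (\<lambda>a::real ^ 'n. \<Sum>k\<in>UNIV. a $ k *\<^sub>R F k) \<subseteq> span (range F)"
    by (intro image_subsetI span_sum span_scale span_base rangeI)
qed

text \<open>Applying \<open>L\<close> to a linear relation among the \<open>F k\<close> recovers its
  coefficients. For the fields \<open>Y_k\<close> the map \<open>L\<close> is \<open>args I\<close>;
  for the \<open>Z_k\<close> it is built from the Hessian blocks.\<close>

lemma independent_range_if_dual:
  fixes F :: "'n::finite \<Rightarrow> 'a::real_vector" and L :: "'a \<Rightarrow> real ^ 'n"
  assumes L: "linear L" and dual: "\<And>k. L (F k) = axis k 1"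
  shows "inj F" "independent (range F)"
proof -
  show inj: "inj F"
    by (rule injI) (metis dual axis_eq_axis zero_neq_one)
  have "u (F k) = 0" if "(\<Sum>v\<in>range F. u v *\<^sub>R v) = 0" for u k
  proof -
    have "(\<Sum>k\<in>UNIV. u (F k) *\<^sub>R F k) = 0"
      using that by (simp add: sum.reindex[OF inj])
    then have "L (\<Sum>k\<in>UNIV. u (F k) *\<^sub>R F k) = 0"
      by (simp add: linear_0[OF L])
    then have "(\<Sum>k\<in>UNIV. (\<chi> k. u (F k)) $ k *\<^sub>R axis k 1) = (0 :: real ^ 'n)"
      by (simp add: linear_sum[OF L] linear_cmul[OF L] dual)
    then have "(\<chi> k. u (F k)) = (0 :: real ^ 'n)"
      unfolding sum_axis_scaleR .
    then show ?thesis by (simp add: vec_eq_iff)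
  qed
  then show "independent (range F)"
    by (auto simp: dependent_finite)
qed

section \<open>The phase space\<close>

text \<open>The complementary half of the coordinates, signed so that it is dual to the frame \<open>W_field I\<close>
  in the same way as \<open>args I\<close> is dual to \<open>V_field I\<close>.\<close>

definition coargs :: "'n::finite set \<Rightarrow> 'n phase \<Rightarrow> real ^ 'n" where
  "coargs I z = (\<chi> k. if k \<in> I then x_of z $ k else - (p_of z $ k))"

text \<open>The value of the metric on the pair \<open>V_k\<close>, \<open>W_k\<close>; outside
  \<open>I\<close> the minus comes from \<open>W_k = -P_k\<close>.\<close>

definition sgn_of :: "'n set \<Rightarrow> 'n \<Rightarrow> real" where
  "sgn_of I k = (if k \<in> I then 1 else - 1)"

lemma linear_args: "linear (args I)" and linear_coargs: "linear (coargs I)"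
  and linear_contact_form: "linear (contact_form z)"
  by (auto intro!: linearI simp: args_def coargs_def contact_form_def dx0_def dx_def p_of_def x_of_def
      vec_eq_iff algebra_simps sum.distrib sum_distrib_left)

lemmas linear_rules = linear_add linear_diff linear_sum linear_cmul linear_0 linear_neg

lemmas args_linear [simp] = linear_rules[OF linear_args]
lemmas coargs_linear [simp] = linear_rules[OF linear_coargs]
lemmas contact_form_linear [simp] = linear_rules[OF linear_contact_form]

lemmas bounded_linear_args = linear_args[unfolded linear_conv_bounded_linear]
lemmas bounded_linear_coargs = linear_coargs[unfolded linear_conv_bounded_linear]

text \<open>\<open>args\<close>, \<open>coargs\<close> and the contact form at a fixed point are
  linear coordinates on tangent vectors: the first two determine dp and dx, after which theta
  determines dx0. Later vector identities are checked in these coordinates.\<close>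

lemma phase_eqI:
  assumes "args I u = args I v" "coargs I u = coargs I v" "contact_form z u = contact_form z v"
  shows "u = v"
proof -
  have p: "p_of u = p_of v" and x: "x_of u = x_of v"
    using assms(1,2) by (auto simp: vec_eq_iff args_def coargs_def split: if_splits)
  moreover have "dx0 u = dx0 v"
    using assms(3) x by (simp add: contact_form_def dx_def)
  ultimately show ?thesis
    by (simp add: p_of_def x_of_def dx0_def prod_eq_iff)
qed

text \<open>For \<open>k\<close> outside \<open>I\<close> the minus sign in \<open>coargs\<close> is
  compensated by \<open>sgn_of\<close>, so both types of index share one hyperbolic formula.\<close>

lemma mrugala_eq:
  "mrugala z u v = (\<Sum>k\<in>UNIV. sgn_of I k *
      (args I u $ k * coargs I v $ k + coargs I u $ k * args I v $ k)) +
    contact_form z u * contact_form z v"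
  unfolding mrugala_def sum_distrib_left
  by (intro arg_cong2[where f = "(+)"] sum.cong)
     (auto simp: sym_prod_def dp_def dx_def args_def coargs_def sgn_of_def algebra_simps)

lemma mrugala_commute: "mrugala z u v = mrugala z v u"
  by (simp add: mrugala_eq[of _ _ _ UNIV] algebra_simps)

lemma bilinear_mrugala: "bilinear (mrugala z)"
  unfolding bilinear_def
  by (intro conjI allI linearI)
    (simp_all add: mrugala_eq[of _ _ _ UNIV] algebra_simps sum.distrib sum_distrib_left)

lemmas linear_mrugala_right = bilinear_mrugala[unfolded bilinear_def, THEN conjunct1, rule_format]
lemmas linear_mrugala_left = bilinear_mrugala[unfolded bilinear_def, THEN conjunct2, rule_format]

text \<open>Together with the Reeb vector d/dx0, these fields are the basis dual to the coordinates
  \<open>args\<close>, \<open>coargs\<close> and theta.\<close>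

lemma args_V [simp]: "args I (V_field I k z) = axis k 1"
  and coargs_V [simp]: "coargs I (V_field I k z) = 0"
  and contact_form_V [simp]: "contact_form z (V_field I k z) = 0"
  and args_W [simp]: "args I (W_field I k z) = 0"
  and coargs_W [simp]: "coargs I (W_field I k z) = axis k 1"
  and contact_form_W [simp]: "contact_form z (W_field I k z) = 0"
  by (auto simp: V_field_def W_field_def P_field_def X_field_def args_def coargs_def
      contact_form_def dx0_def dx_def p_of_def x_of_def vec_eq_iff axis_def
      if_distrib[of "\<lambda>x. _ * x"] sum_negf cong: if_cong)

text \<open>Pairing with \<open>W_k\<close>, \<open>V_k\<close> and the Reeb vector
  \<open>(1, 0, 0)\<close> reads off the coordinates; with \<open>I = UNIV\<close> every sign is
  1.\<close>

lemma mrugala_nondegenerate: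
  assumes "\<And>c. mrugala z u c = mrugala z v c"
  shows "u = v"
proof -
  define I :: "'a set" where "I = UNIV"
  have contact: "contact_form z (1, 0, 0) = 1" "args I (1, 0, 0) = (0 :: real ^ 'a)"
      "coargs I (1, 0, 0) = (0 :: real ^ 'a)"
    by (simp_all add: I_def contact_form_def dx0_def dx_def x_of_def args_def coargs_def p_of_def vec_eq_iff)
  have eq: "(\<Sum>k\<in>UNIV. args I u $ k * coargs I c $ k + coargs I u $ k * args I c $ k) +
      contact_form z u * contact_form z c =
    (\<Sum>k\<in>UNIV. args I v $ k * coargs I c $ k + coargs I v $ k * args I c $ k) +
      contact_form z v * contact_form z c" for c
    using assms[of c] by (simp add: mrugala_eq[of _ _ _ I] sgn_of_def I_def)
  show ?thesis
  proof (rule phase_eqI)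
    show "args I u = args I v"
      using eq[of "W_field I _ z"]
      by (simp add: vec_eq_iff axis_def if_distrib[of "\<lambda>x. _ * x"] cong: if_cong)
    show "coargs I u = coargs I v"
      using eq[of "V_field I _ z"]
      by (simp add: vec_eq_iff axis_def if_distrib[of "\<lambda>x. _ * x"] cong: if_cong)
    show "contact_form z u = contact_form z v"
      using eq[of "(1, 0, 0)"] by (simp add: contact)
  qed
qed

lemma smooth_on_phase:
  fixes a :: "'a::euclidean_space \<Rightarrow> real" and b c :: "'n::finite \<Rightarrow> 'a \<Rightarrow> real"
  assumes S: "open S" and "smooth_on S a" "\<And>k. smooth_on S (b k)" "\<And>k. smooth_on S (c k)"
  shows "smooth_on S (\<lambda>z. (a z, \<chi> k. b k z, \<chi> k. c k z) :: 'n phase)"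
proof -
  have 1: "smooth_on S (\<lambda>z. a z *\<^sub>R (1, 0, 0) + ((\<Sum>k\<in>UNIV. b k z *\<^sub>R (0, axis k 1, 0)) +
      (\<Sum>k\<in>UNIV. c k z *\<^sub>R (0, 0, axis k 1))) :: 'n phase)"
    using assms by (intro smooth_on_add smooth_on_sum smooth_on_scaleR smooth_on_const) auto
  have 2: "(\<Sum>k\<in>UNIV. b k z *\<^sub>R (0, axis k 1, 0)) = (0, \<chi> k. b k z, 0 :: real ^ 'n)" for z
    using sum_axis_scaleR[of "\<chi> k. b k z"] by (simp add: prod_eq_iff fst_sum snd_sum)
  have 3: "(\<Sum>k\<in>UNIV. c k z *\<^sub>R (0, 0, axis k 1)) = (0, 0 :: real ^ 'n, \<chi> k. c k z)" for z
    using sum_axis_scaleR[of "\<chi> k. c k z"] by (simp add: prod_eq_iff fst_sum snd_sum)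
  show ?thesis using 1 unfolding 2 3 by simp
qed

lemma smooth_on_V: "open S \<Longrightarrow> smooth_on S (V_field I k)"
  and smooth_on_W: "open S \<Longrightarrow> smooth_on S (W_field I k)"
proof -
  assume S: "open S"
  have P: "smooth_on S (P_field k)"
    unfolding P_field_def by simp
  have "bounded_linear (\<lambda>z :: 'a phase. - (p_of z $ k))"
    unfolding linear_conv_bounded_linear[symmetric] by (rule linearI) (simp_all add: p_of_def)
  then have X: "smooth_on S (X_field k)"
    using smooth_on_phase[OF S smooth_on_linear, of "\<lambda>z. - (p_of z $ k)" "\<lambda>l _. 0" "\<lambda>l _. axis k 1 $ l"]
    by (simp add: X_field_def[abs_def] zero_vec_def)
  show "smooth_on S (V_field I k)"
    using P X by (cases "k \<in> I") (simp_all add: V_field_def[abs_def])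
  show "smooth_on S (W_field I k)"
    using X smooth_on_minus[OF S P] by (cases "k \<in> I") (simp_all add: W_field_def[abs_def])
qed

section \<open>The Levi-Civita connection of the Mrugala metric\<close>

text \<open>The form b. \<open>pairing v u\<close> is the derivative of theta(u), for constant u, as
  the base point moves along v; the antisymmetrisation of b is d theta.\<close>

definition pairing :: "'n::finite phase \<Rightarrow> 'n phase \<Rightarrow> real" where
  "pairing u v = (\<Sum>k\<in>UNIV. dp k u * dx k v)"

text \<open>The left side is d theta(u, v); the sign in \<open>coargs\<close> makes the split
  coordinates symplectic for every choice of \<open>I\<close>.\<close>

lemma pairing_diff_commute:
  "pairing u v - pairing v u = (\<Sum>k\<in>UNIV. args I u $ k * coargs I v $ k - coargs I u $ k * args I v $ k)"
  unfolding pairing_def sum_subtractf[symmetric]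
  by (intro sum.cong) (auto simp: dp_def dx_def args_def coargs_def algebra_simps)

lemma has_derivative_contact_form:
  assumes "(Y has_derivative Y') (at z)"
  shows "((\<lambda>z. contact_form z (Y z)) has_derivative
    (\<lambda>v. contact_form z (Y' v) + pairing v (Y z))) (at z)"
proof -
  have bl: "bounded_linear (dx0 :: 'a phase \<Rightarrow> real)" "\<And>k::'a. bounded_linear (dp k)" "\<And>k::'a. bounded_linear (dx k)"
    unfolding linear_conv_bounded_linear[symmetric]
    by (auto intro!: linearI simp: dx0_def dp_def dx_def p_of_def x_of_def)
  show ?thesis
    unfolding contact_form_def pairing_def dp_def[symmetric]
    by (rule derivative_eq_intros bounded_linear.has_derivative[OF bl(1)] bounded_linear.has_derivative[OF bl(3)]
        bounded_linear_imp_has_derivative[OF bl(2)] assms refl)+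
      (simp add: sum.distrib algebra_simps)
qed

text \<open>Only the summand theta \<otimes> theta has coefficients that vary with the base point;
  each of its factors contributes one \<open>pairing\<close> term.\<close>

lemma has_derivative_mrugala:
  assumes Y: "(Y has_derivative Y') (at z)" and Z: "(Z has_derivative Z') (at z)"
  shows "((\<lambda>z. mrugala z (Y z) (Z z)) has_derivative
    (\<lambda>v. mrugala z (Y' v) (Z z) + mrugala z (Y z) (Z' v) +
      pairing v (Y z) * contact_form z (Z z) + contact_form z (Y z) * pairing v (Z z))) (at z)"
proof -
  have bl: "\<And>k::'a. bounded_linear (dp k)" "\<And>k::'a. bounded_linear (dx k)"
    unfolding linear_conv_bounded_linear[symmetric]
    by (auto intro!: linearI simp: dp_def dx_def p_of_def x_of_def)
  have eq: "mrugala z u v = (\<Sum>k\<in>UNIV. dp k u * dx k v + dx k u * dp k v) + contact_form z u * contact_form z v"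
    for z u v :: "'a phase"
    by (simp add: mrugala_def sym_prod_def sum_distrib_left add_divide_distrib)
  note D = bounded_linear.has_derivative[OF bl(1) Y] bounded_linear.has_derivative[OF bl(2) Y]
    bounded_linear.has_derivative[OF bl(1) Z] bounded_linear.has_derivative[OF bl(2) Z]
  show ?thesis
    unfolding eq
    by (rule derivative_eq_intros D has_derivative_contact_form[OF Y] has_derivative_contact_form[OF Z] refl)+
      (simp add: sum.distrib algebra_simps)
qed

text \<open>Koszul's formula with a constant third field.\<close>

lemma levi_civita_mrugala:
  assumes LC: "levi_civita_on W mrugala nabla" and X: "smooth_on W X" and Y: "smooth_on W Y"
    and q: "q \<in> W" and X0: "contact_form q (X q) = 0" and Y0: "contact_form q (Y q) = 0"
  shows "nabla X Y q = deriv_along X Y q + ((pairing (X q) (Y q) + pairing (Y q) (X q)) / 2, 0, 0)"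
proof (rule mrugala_nondegenerate)
  fix c
  define C :: "'a phase \<Rightarrow> 'a phase" where "C = (\<lambda>_. c)"
  have C: "smooth_on W C" by (simp add: C_def)
  have DC: "deriv_along A C q = 0" for A
    by (simp add: deriv_along_def C_def)
  have leibniz: "deriv_along A (\<lambda>z. mrugala z (B z) (D z)) q =
      mrugala q (deriv_along A B q) (D q) + mrugala q (B q) (deriv_along A D q) +
      pairing (A q) (B q) * contact_form q (D q) + contact_form q (B q) * pairing (A q) (D q)"
    if "smooth_on W B" "smooth_on W D" for A B D
    unfolding deriv_along_def
    by (simp add: frechet_derivative_eqI[OF has_derivative_mrugala[OF
        smooth_on_has_derivative[OF that(1) q] smooth_on_has_derivative[OF that(2) q]]])
  have compat: "deriv_along A (\<lambda>z. mrugala z (B z) (D z)) q =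
      mrugala q (nabla A B q) (D q) + mrugala q (B q) (nabla A D q)"
    if "smooth_on W A" "smooth_on W B" "smooth_on W D" for A B D
    using LC that q unfolding levi_civita_on_def by blast
  have torsion: "nabla A B q = nabla B A q + deriv_along A B q - deriv_along B A q"
    if "smooth_on W A" "smooth_on W B" for A B
  proof -
    have "nabla A B q - nabla B A q = lie_bracket A B q"
      using LC that q unfolding levi_civita_on_def by blast
    then show ?thesis by (simp add: lie_bracket_def algebra_simps)
  qed
  note lin = linear_rules[OF linear_mrugala_left] linear_rules[OF linear_mrugala_right]
  \<comment> \<open>Compatibility is compared with the Leibniz rule for the pairs
    \<open>(Y, C)\<close>, \<open>(X, C)\<close> and \<open>(X, Y)\<close>. Since theta vanishes on
    \<open>X\<close> and \<open>Y\<close> at \<open>q\<close>, only \<open>pairing\<close> terms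
    multiplied by theta(c) survive.\<close>
  have 1: "mrugala q (nabla X Y q) c + mrugala q (Y q) (nabla X C q) =
      mrugala q (deriv_along X Y q) c + pairing (X q) (Y q) * contact_form q c"
    using compat[OF X Y C] leibniz[OF Y C, of X] by (simp add: DC lin Y0) (simp add: C_def)
  have 2: "mrugala q (nabla Y X q) c + mrugala q (X q) (nabla Y C q) =
      mrugala q (deriv_along Y X q) c + pairing (Y q) (X q) * contact_form q c"
    using compat[OF Y X C] leibniz[OF X C, of Y] by (simp add: DC lin X0) (simp add: C_def)
  have 3: "mrugala q (nabla C X q) (Y q) + mrugala q (X q) (nabla C Y q) =
      mrugala q (deriv_along C X q) (Y q) + mrugala q (X q) (deriv_along C Y q)"
    using compat[OF C X Y] leibniz[OF X Y, of C] by (simp add: X0 Y0)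
  \<comment> \<open>Vanishing torsion trades \<open>nabla X C\<close> for \<open>nabla C X\<close>,
    and likewise for \<open>Y\<close>, so 1 + 2 - 3 leaves only \<open>nabla X Y\<close>,
    \<open>nabla Y X\<close> and known terms; 6 then eliminates \<open>nabla Y X\<close>.\<close>
  have 4: "mrugala q (Y q) (nabla X C q) = mrugala q (nabla C X q) (Y q) - mrugala q (deriv_along C X q) (Y q)"
    by (simp add: torsion[OF X C] DC lin mrugala_commute[of q "Y q"])
  have 5: "mrugala q (X q) (nabla Y C q) = mrugala q (X q) (nabla C Y q) - mrugala q (X q) (deriv_along C Y q)"
    by (simp add: torsion[OF Y C] DC lin)
  have 6: "mrugala q (nabla Y X q) c = mrugala q (nabla X Y q) c + mrugala q (deriv_along Y X q) c -
      mrugala q (deriv_along X Y q) c"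
    by (simp add: torsion[OF Y X] lin)
  \<comment> \<open>The Reeb vector is metrically dual to theta, which turns the theta(c) terms into
    a component of the connection.\<close>
  have 7: "mrugala q (r, 0, 0) c = r * contact_form q c" for r
    by (simp add: mrugala_def sym_prod_def dp_def dx_def p_of_def x_of_def contact_form_def[of q "(r, 0, 0)"] dx0_def)
  show "mrugala q (nabla X Y q) c =
      mrugala q (deriv_along X Y q + ((pairing (X q) (Y q) + pairing (Y q) (X q)) / 2, 0, 0)) c"
    using 1 2 3 4 5 6 by (simp add: lin 7 field_simps)
qed

section \<open>The generating function and its graph\<close>

lemma args_Y [simp]: "args I (Y_field I \<phi> k z) = axis k 1"
  and coargs_Y [simp]: "coargs I (Y_field I \<phi> k z) = hessian \<phi> (args I z) $ k"
  and contact_form_Y [simp]: "contact_form z (Y_field I \<phi> k z) = 0"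
  by (simp_all add: Y_field_def sum_axis_scaleR)

section \<open>Parametrisation of the graph and its derivative\<close>

lemma has_derivative_partial:
  assumes "f differentiable (at u)"
  shows "(f has_derivative (\<lambda>a. \<Sum>k\<in>UNIV. a $ k * partial f k u)) (at u)"
proof -
  note L = linear_frechet_derivative[OF assms]
  have "frechet_derivative f (at u) a = (\<Sum>k\<in>UNIV. a $ k * partial f k u)" for a
  proof -
    have "frechet_derivative f (at u) a = frechet_derivative f (at u) (\<Sum>k\<in>UNIV. a $ k *\<^sub>R axis k 1)"
      by (simp only: sum_axis_scaleR)
    also have "\<dots> = (\<Sum>k\<in>UNIV. a $ k * partial f k u)"
      by (simp add: linear_sum[OF L] linear_cmul[OF L] partial_def)
    finally show ?thesis .
  qed
  then have "frechet_derivative f (at u) = (\<lambda>a. \<Sum>k\<in>UNIV. a $ k * partial f k u)" ..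
  with has_derivative_frechet[OF assms] show ?thesis by simp
qed

text \<open>The defining equations of the graph, solved for the phase point as a function of
  \<open>u\<close>; on the graph \<open>args I\<close> is the inverse chart.\<close>

definition legendre_param :: "'n::finite set \<Rightarrow> (real ^ 'n \<Rightarrow> real) \<Rightarrow> real ^ 'n \<Rightarrow> 'n phase" where
  "legendre_param I \<phi> u =
    (\<phi> u - (\<Sum>i\<in>I. u $ i * partial \<phi> i u),
     \<chi> k. if k \<in> I then u $ k else - partial \<phi> k u,
     \<chi> k. if k \<in> I then partial \<phi> k u else u $ k)"

lemma args_param [simp]: "args I (legendre_param I \<phi> u) = u"
  and coargs_param: "coargs I (legendre_param I \<phi> u) = (\<chi> k. partial \<phi> k u)"
  by (auto simp: legendre_param_def args_def coargs_def p_of_def x_of_def vec_eq_iff)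

locale generating_function =
  fixes I J :: "'n::finite set" and U :: "(real ^ 'n) set" and \<phi> :: "real ^ 'n \<Rightarrow> real"
  assumes cover: "I \<union> J = UNIV" and disjoint: "I \<inter> J = {}"
    and open_U: "open U" and smooth_phi: "smooth_on U \<phi>"
begin

abbreviation "\<Sigma> \<equiv> legendre_graph I J U \<phi>"
abbreviation "F \<equiv> legendre_param I \<phi>"
abbreviation "H \<equiv> hessian \<phi>"
abbreviation "Y \<equiv> Y_field I \<phi>"
abbreviation "Z \<equiv> Z_field I J \<phi>"

lemma J_iff: "k \<in> J \<longleftrightarrow> k \<notin> I"
  using cover disjoint by blast

lemma graph_eq: "\<Sigma> = F ` U"
proof
  show "\<Sigma> \<subseteq> F ` U"
  proof
    fix z assume z: "z \<in> \<Sigma>"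
    have "z = F (args I z)"
      using z by (auto simp: legendre_graph_def legendre_param_def J_iff prod_eq_iff vec_eq_iff p_of_def
          x_of_def args_def)
    then show "z \<in> F ` U" using z by (auto simp: legendre_graph_def)
  qed
  show "F ` U \<subseteq> \<Sigma>"
    by (auto simp: legendre_graph_def J_iff) (auto simp: legendre_param_def p_of_def x_of_def)
qed

lemma args_in_U: "q \<in> \<Sigma> \<Longrightarrow> args I q \<in> U"
  and param_args: "q \<in> \<Sigma> \<Longrightarrow> F (args I q) = q"
  by (auto simp: graph_eq)

lemma smooth_partial: "smooth_on U (partial \<phi> k)"
  unfolding partial_def[abs_def] by (rule smooth_on_directional[OF smooth_phi])

lemma smooth_hessian: "smooth_on U (\<lambda>u. H u $ k $ l)"
  using smooth_on_directional[OF smooth_partial[of k], of "axis l 1"]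
  by (simp add: hessian_def partial_def[of "partial \<phi> k"])

lemma hessian_sym: "u \<in> U \<Longrightarrow> H u $ k $ l = H u $ l $ k"
  using directional_derivatives_commute[OF open_U smooth_phi]
  by (simp add: hessian_def partial_def[abs_def])

lemma smooth_param: "smooth_on U F"
proof -
  have c: "smooth_on U (\<lambda>u. u $ k)" for k
    by (rule smooth_on_linear[OF bounded_linear_vec_nth])
  have ite: "smooth_on U (\<lambda>u. if k \<in> I then f u else g u)" if "smooth_on U f" "smooth_on U g"
    for k and f g :: "real ^ 'n \<Rightarrow> real"
    using that by (cases "k \<in> I") simp_all
  show ?thesis
    unfolding legendre_param_def[abs_def]
    by (intro smooth_on_phase open_U smooth_on_diff smooth_phi smooth_on_sum smooth_on_mult c
        smooth_partial smooth_on_minus ite)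
qed

text \<open>The derivative exists by smoothness, so only its coordinates have to be identified:
  \<open>args\<close> yields the identity, \<open>coargs\<close> the Hessian, and theta yields 0,
  which is the Legendre condition.\<close>

lemma has_derivative_param:
  assumes u: "u \<in> U"
  shows "(F has_derivative (\<lambda>a. \<Sum>k\<in>UNIV. a $ k *\<^sub>R Y k (F u))) (at u)"
proof -
  define D where "D = frechet_derivative F (at u)"
  have D: "(F has_derivative D) (at u)"
    unfolding D_def by (rule smooth_on_has_derivative[OF smooth_param u])
  have "D a = (\<Sum>k\<in>UNIV. a $ k *\<^sub>R Y k (F u))" for a
  proof (rule phase_eqI)
    have "((\<lambda>u. args I (F u)) has_derivative (\<lambda>a. args I (D a))) (at u)"
      by (rule bounded_linear.has_derivative[OF bounded_linear_args D])
    then have args_D: "(\<lambda>a. args I (D a)) = (\<lambda>a. a)"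
      using has_derivative_unique[OF _ has_derivative_ident] by simp
    then show "args I (D a) = args I (\<Sum>k\<in>UNIV. a $ k *\<^sub>R Y k (F u))"
      by (simp add: sum_axis_scaleR fun_eq_iff)
    have dpart: "(partial \<phi> l has_derivative (\<lambda>a. \<Sum>k\<in>UNIV. a $ k * H u $ l $ k)) (at u)" for l
      using has_derivative_partial[OF smooth_on_differentiable[OF smooth_partial u, of l]]
      by (simp add: hessian_def)
    have "((\<lambda>u. coargs I (F u) $ l) has_derivative (\<lambda>a. coargs I (D a) $ l)) (at u)" for l
      by (intro bounded_linear.has_derivative[OF bounded_linear_vec_nth]
          bounded_linear.has_derivative[OF bounded_linear_coargs D])
    then have coargs_D: "(\<lambda>a. coargs I (D a) $ l) = (\<lambda>a. \<Sum>k\<in>UNIV. a $ k * H u $ l $ k)" for l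
      using has_derivative_unique[OF _ dpart[of l]] by (simp add: coargs_param)
    then show "coargs I (D a) = coargs I (\<Sum>k\<in>UNIV. a $ k *\<^sub>R Y k (F u))"
      using hessian_sym[OF u] by (simp add: vec_eq_iff fun_eq_iff)
    have dphi: "(\<phi> has_derivative (\<lambda>a. \<Sum>k\<in>UNIV. a $ k * partial \<phi> k u)) (at u)"
      by (rule has_derivative_partial[OF smooth_on_differentiable[OF smooth_phi u]])
    have "((\<lambda>u. \<phi> u - (\<Sum>i\<in>I. u $ i * partial \<phi> i u)) has_derivative
        (\<lambda>a. (\<Sum>k\<in>UNIV. a $ k * partial \<phi> k u) -
          (\<Sum>i\<in>I. u $ i * (\<Sum>k\<in>UNIV. a $ k * H u $ i $ k) + a $ i * partial \<phi> i u))) (at u)"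
      by (intro has_derivative_diff has_derivative_sum has_derivative_mult dphi dpart
          bounded_linear_imp_has_derivative bounded_linear_vec_nth)
    moreover have "((\<lambda>u. fst (F u)) has_derivative (\<lambda>a. fst (D a))) (at u)"
      by (intro bounded_linear.has_derivative[OF bounded_linear_fst] D)
    ultimately have fst_D: "(\<lambda>a. fst (D a)) = (\<lambda>a. (\<Sum>k\<in>UNIV. a $ k * partial \<phi> k u) -
          (\<Sum>i\<in>I. u $ i * (\<Sum>k\<in>UNIV. a $ k * H u $ i $ k) + a $ i * partial \<phi> i u))"
      using has_derivative_unique by (simp add: legendre_param_def) blast
    \<comment> \<open>On \<open>I\<close>, p_i = u_i and dx^i = d\<phi>_i; on the complement, p_j =
      -\<phi>_j and dx^j = du_j.\<close>
    have p: "p_of (F u) $ k * dx k (D a) =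
        (if k \<in> I then u $ k * (\<Sum>l\<in>UNIV. a $ l * H u $ k $ l) else - (a $ k * partial \<phi> k u))" for k
    proof (cases "k \<in> I")
      case True
      then have "dx k (D a) = coargs I (D a) $ k" by (simp add: dx_def coargs_def)
      with True show ?thesis
        using coargs_D[of k]
        by (simp add: legendre_param_def p_of_def fun_eq_iff)
    next
      case False
      then have "dx k (D a) = args I (D a) $ k" by (simp add: dx_def args_def)
      with False show ?thesis
        using args_D
        by (simp add: legendre_param_def p_of_def fun_eq_iff)
    qed
    \<comment> \<open>Adding and subtracting \<open>a $ k * partial \<phi> k u\<close> for
      \<open>k\<close> in \<open>I\<close> brings the sum into the form of the negative of the dx0
      component in \<open>fst_D\<close>.\<close>
    have "(\<Sum>k\<in>UNIV. p_of (F u) $ k * dx k (D a)) =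
      (\<Sum>k\<in>UNIV. (if k \<in> I then u $ k * (\<Sum>l\<in>UNIV. a $ l * H u $ k $ l) + a $ k * partial \<phi> k u else 0) -
        a $ k * partial \<phi> k u)"
      unfolding p by (intro sum.cong) auto
    also have "\<dots> = (\<Sum>k\<in>I. u $ k * (\<Sum>l\<in>UNIV. a $ l * H u $ k $ l) + a $ k * partial \<phi> k u) -
        (\<Sum>k\<in>UNIV. a $ k * partial \<phi> k u)"
      by (simp add: sum_subtractf sum.If_cases)
    finally have "contact_form (F u) (D a) = 0"
      using fst_D by (simp add: contact_form_def dx0_def fun_eq_iff)
    then show "contact_form (F u) (D a) = contact_form (F u) (\<Sum>k\<in>UNIV. a $ k *\<^sub>R Y k (F u))"
      by simp
  qed
  then show ?thesis using D by presburger
qed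

text \<open>A curve in the graph is \<open>F\<close> applied to its own \<open>args\<close>, so its
  velocity \<open>v\<close> is the combination of the \<open>Y_k\<close> with coefficients
  \<open>args I v\<close>. Conversely, \<open>F\<close> maps a short segment through
  \<open>args I q\<close> in direction \<open>a\<close> to a curve with the required
  velocity.\<close>

lemma tangent_space_eq:
  assumes q: "q \<in> \<Sigma>"
  shows "tangent_space \<Sigma> q = range (\<lambda>a. \<Sum>k\<in>UNIV. a $ k *\<^sub>R Y k q)"
proof
  show "tangent_space \<Sigma> q \<subseteq> range (\<lambda>a. \<Sum>k\<in>UNIV. a $ k *\<^sub>R Y k q)"
  proof
    fix v assume "v \<in> tangent_space \<Sigma> q"
    then obtain c e where e: "e > 0" and c: "c ` {-e<..<e} \<subseteq> \<Sigma>" "c 0 = q"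
      and v: "(c has_vector_derivative v) (at 0)"
      unfolding tangent_space_def by blast
    have cd: "(c has_derivative (\<lambda>t. t *\<^sub>R v)) (at 0)"
      using v by (simp add: has_vector_derivative_def)
    have "((\<lambda>t. F (args I (c t))) has_derivative
        (\<lambda>t. \<Sum>k\<in>UNIV. args I (t *\<^sub>R v) $ k *\<^sub>R Y k (F (args I (c 0))))) (at 0)"
      using has_derivative_compose[OF bounded_linear.has_derivative[OF bounded_linear_args cd]
          has_derivative_param] args_in_U q c(2) by simp
    then have "((\<lambda>t. F (args I (c t))) has_derivative
        (\<lambda>t. \<Sum>k\<in>UNIV. args I (t *\<^sub>R v) $ k *\<^sub>R Y k q)) (at 0)"
      by (simp only: c(2) param_args[OF q])
    then have "(c has_derivative (\<lambda>t. \<Sum>k\<in>UNIV. args I (t *\<^sub>R v) $ k *\<^sub>R Y k q)) (at 0)"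
    proof (rule has_derivative_transform_within_open)
      show "F (args I (c t)) = c t" if "t \<in> {-e<..<e}" for t
        using c(1) that by (intro param_args) blast
    qed (use e in auto)
    from fun_cong[OF has_derivative_unique[OF this cd], of 1]
    have "v = (\<Sum>k\<in>UNIV. args I v $ k *\<^sub>R Y k q)" by simp
    then show "v \<in> range (\<lambda>a. \<Sum>k\<in>UNIV. a $ k *\<^sub>R Y k q)" by (rule range_eqI)
  qed
  show "range (\<lambda>a. \<Sum>k\<in>UNIV. a $ k *\<^sub>R Y k q) \<subseteq> tangent_space \<Sigma> q"
  proof (rule image_subsetI)
    fix a :: "real ^ 'n"
    define u where "u = args I q"
    have u: "u \<in> U" "F u = q" using args_in_U param_args q by (simp_all add: u_def)
    obtain d where d: "d > 0" "ball u d \<subseteq> U" using open_U u open_contains_ball by blast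
    \<comment> \<open>With this \<open>e\<close> the segment stays in the ball of radius
      \<open>d\<close>; the summand 1 covers \<open>a = 0\<close>.\<close>
    define e where "e = d / (norm a + 1)"
    have N: "norm a + 1 > 0" by (simp add: add_nonneg_pos)
    then have e: "e > 0" using d by (simp add: e_def)
    have bl: "bounded_linear (\<lambda>t. t *\<^sub>R a)" by (rule bounded_linear_scaleR_left)
    have inU: "u + t *\<^sub>R a \<in> U" if "t \<in> {-e<..<e}" for t
    proof -
      have "\<bar>t\<bar> * norm a \<le> \<bar>t\<bar> * (norm a + 1)" by (simp add: mult_left_mono)
      also have "\<dots> < e * (norm a + 1)" using that N by (intro mult_strict_right_mono) auto
      also have "\<dots> = d" using N by (simp add: e_def)
      finally have "u + t *\<^sub>R a \<in> ball u d" by (simp add: dist_norm)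
      then show ?thesis using d by blast
    qed
    have "((\<lambda>t. F (u + t *\<^sub>R a)) has_derivative (\<lambda>t. \<Sum>k\<in>UNIV. (t *\<^sub>R a) $ k *\<^sub>R Y k q)) (at 0)"
    proof -
      have "((\<lambda>t. u + t *\<^sub>R a) has_derivative (\<lambda>t. t *\<^sub>R a)) (at 0)"
        by (auto intro!: derivative_eq_intros)
      from has_derivative_compose[OF this, of F "\<lambda>a. \<Sum>k\<in>UNIV. a $ k *\<^sub>R Y k q"]
      show ?thesis using has_derivative_param[OF u(1)] u(2) by simp
    qed
    then have vd: "((\<lambda>t. F (u + t *\<^sub>R a)) has_vector_derivative (\<Sum>k\<in>UNIV. a $ k *\<^sub>R Y k q)) (at 0)"
      by (simp add: has_vector_derivative_def scaleR_sum_right)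
    have sm: "smooth_on {-e<..<e} (\<lambda>t. F (u + t *\<^sub>R a))"
      by (rule smooth_on_compose_affine[OF bl _ smooth_param inU]) auto
    show "(\<Sum>k\<in>UNIV. a $ k *\<^sub>R Y k q) \<in> tangent_space \<Sigma> q"
      unfolding tangent_space_def mem_Collect_eq
      by (rule exI[of _ "\<lambda>t. F (u + t *\<^sub>R a)"], rule exI[of _ e])
        (use e inU u vd sm in \<open>auto simp: graph_eq\<close>)
  qed
qed

lemma tangent_space_contact: "q \<in> \<Sigma> \<Longrightarrow> tangent_space \<Sigma> q \<subseteq> contact_dist q"
  by (auto simp: tangent_space_eq contact_dist_def)

text \<open>The graph has one global chart, \<open>F\<close> with inverse \<open>args I\<close>, so
  the same data, with \<open>W\<close> the whole space and \<open>A = U\<close>, serve every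
  point.\<close>

lemma legendre: "legendre_submanifold \<Sigma>"
  unfolding legendre_submanifold_def
proof (intro conjI ballI)
  fix q assume "q \<in> \<Sigma>"
  have "inj (frechet_derivative F (at u))" if "u \<in> U" for u
  proof (rule injI)
    fix a b assume "frechet_derivative F (at u) a = frechet_derivative F (at u) b"
    then have "args I (\<Sum>k\<in>UNIV. a $ k *\<^sub>R Y k (F u)) = args I (\<Sum>k\<in>UNIV. b $ k *\<^sub>R Y k (F u))"
      by (simp add: frechet_derivative_eqI[OF has_derivative_param[OF that]])
    then show "a = b" by (simp add: sum_axis_scaleR)
  qed
  moreover have "homeomorphism U \<Sigma> F (args I)"
    unfolding homeomorphism_def using smooth_on_continuous_on[OF smooth_param]
    by (auto simp: graph_eq image_image linear_continuous_on[OF bounded_linear_args])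
  ultimately show "\<exists>W (A :: (real ^ 'n) set) f h. open W \<and> q \<in> W \<and> open A \<and> smooth_on A f \<and>
      (\<forall>u\<in>A. inj (frechet_derivative f (at u))) \<and> homeomorphism A (\<Sigma> \<inter> W) f h"
    using open_U smooth_param
    by (intro exI[of _ UNIV] exI[of _ U] exI[of _ F] exI[of _ "args I"]) auto
qed (rule tangent_space_contact)

section \<open>Smoothness and frame property of the fields \<open>Y_k\<close>\<close>

lemma open_args_vimage: "open V \<Longrightarrow> open {z. args I z \<in> V}"
  using open_vimage[OF _ linear_continuous_on[OF bounded_linear_args, of UNIV I]]
  by (simp add: vimage_def)

lemma smooth_compose_args:
  assumes "smooth_on V f" "open S" "\<And>z. z \<in> S \<Longrightarrow> args I z \<in> V"
  shows "smooth_on S (\<lambda>z. f (args I z))"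
  using smooth_on_compose_affine[OF bounded_linear_args[of I] assms(2,1), of 0] assms(3) by simp

lemma smooth_Y:
  assumes "open S" "\<And>z. z \<in> S \<Longrightarrow> args I z \<in> U"
  shows "smooth_on S (Y k)"
  unfolding Y_field_def[abs_def]
  by (intro smooth_on_add smooth_on_sum smooth_on_scaleR smooth_on_V smooth_on_W
      smooth_compose_args[OF smooth_hessian] assms)

text \<open>\<open>args I\<close> sends \<open>Y k q\<close> to the k-th unit vector, which gives
  independence; each \<open>Y k\<close> is its own smooth extension to the open set of points with
  arguments in \<open>U\<close>.\<close>

lemma frame_Y: "frame_on \<Sigma> (tangent_space \<Sigma>) Y"
  unfolding frame_on_def
proof (intro conjI allI ballI)
  fix k
  show "smooth_field_along \<Sigma> (Y k)"
    unfolding smooth_field_along_def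
  proof
    fix q assume "q \<in> \<Sigma>"
    then show "\<exists>W X'. open W \<and> q \<in> W \<and> smooth_on W X' \<and> (\<forall>z\<in>W \<inter> \<Sigma>. X' z = Y k z)"
      using open_args_vimage[OF open_U] args_in_U
      by (intro exI[of _ "{z. args I z \<in> U}"] exI[of _ "Y k"]) (auto intro: smooth_Y)
  qed
next
  fix q assume "q \<in> \<Sigma>"
  then show "span (range (\<lambda>k. Y k q)) = tangent_space \<Sigma> q"
    by (simp add: span_range_eq tangent_space_eq)
qed (rule independent_range_if_dual[OF linear_args args_Y])+

section \<open>Nondegeneracy and the orthogonal bundle\<close>

text \<open>Keeping both diagonal blocks in one n by n matrix lets a single matrix inverse serve for
  both. Up to the factors 2 \<open>sgn_of\<close>, it is the Gram matrix of the restricted metric in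
  the frame \<open>Y\<close>.\<close>

definition blocks :: "real ^ 'n \<Rightarrow> real ^ 'n ^ 'n" where
  "blocks u = (\<chi> k l. if (k \<in> I) = (l \<in> I) then H u $ k $ l else 0)"

lemma sgn_hessian: "(sgn_of I k + sgn_of I l) * H u $ k $ l = 2 * sgn_of I l * blocks u $ k $ l"
  by (simp add: blocks_def sgn_of_def)

lemma blocks_sym: "u \<in> U \<Longrightarrow> blocks u $ k $ l = blocks u $ l $ k"
  using hessian_sym by (auto simp: blocks_def)

lemma mrugala_Y:
  assumes "contact_form q v = 0"
  shows "mrugala q (Y m q) v = sgn_of I m * coargs I v $ m +
    (\<Sum>k\<in>UNIV. sgn_of I k * H (args I q) $ m $ k * args I v $ k)"
  using assms
  by (simp add: mrugala_eq[of _ _ _ I] distrib_left sum.distrib axis_def mult.assoc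
      if_distrib[of "\<lambda>x. x * _"] if_distrib[of "\<lambda>x. _ * x"] cong: if_cong)

text \<open>G(Y_m, Y_k) is the Hessian entry times the sum of the signs of k and m, so the mixed
  entries cancel and the others double.\<close>

lemma mrugala_Y_combination:
  assumes "q \<in> \<Sigma>"
  shows "mrugala q (Y m q) (\<Sum>k\<in>UNIV. a $ k *\<^sub>R Y k q) = 2 * sgn_of I m * (blocks (args I q) *v a) $ m"
proof -
  have "mrugala q (Y m q) (\<Sum>k\<in>UNIV. a $ k *\<^sub>R Y k q) =
      (\<Sum>k\<in>UNIV. a $ k * ((sgn_of I k + sgn_of I m) * H (args I q) $ k $ m))"
    using hessian_sym[OF args_in_U[OF assms]]
    by (subst mrugala_Y) (simp_all add: sum_axis_scaleR sum_distrib_left algebra_simps sum.distrib)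
  also have "\<dots> = 2 * sgn_of I m * (blocks (args I q) *v a) $ m"
    unfolding sgn_hessian
    by (simp add: matrix_vector_mult_def sum_distrib_left blocks_sym[OF args_in_U[OF assms], of m] mult_ac)
  finally show ?thesis .
qed

lemma orthogonal_iff:
  assumes "q \<in> \<Sigma>"
  shows "v \<in> orthogonal_space mrugala \<Sigma> q \<longleftrightarrow> (\<forall>m. mrugala q (Y m q) v = 0)"
proof
  assume v: "v \<in> orthogonal_space mrugala \<Sigma> q"
  have "Y m q \<in> tangent_space \<Sigma> q" for m
  proof -
    have "Y m q \<in> span (range (\<lambda>k. Y k q))" by (intro span_base rangeI)
    then show ?thesis using frame_Y assms by (simp add: frame_on_def)
  qed
  then show "\<forall>m. mrugala q (Y m q) v = 0" using v by (simp add: orthogonal_space_def)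
next
  assume "\<forall>m. mrugala q (Y m q) v = 0"
  then have "mrugala q (\<Sum>k\<in>UNIV. a $ k *\<^sub>R Y k q) v = 0" for a
    by (simp add: linear_sum[OF linear_mrugala_left] linear_cmul[OF linear_mrugala_left])
  then show "v \<in> orthogonal_space mrugala \<Sigma> q"
    by (simp add: orthogonal_space_def tangent_space_eq[OF assms])
qed

text \<open>A kernel vector of the blocks gives, as coefficients of the \<open>Y_k\<close>, a
  tangent vector orthogonal to the whole tangent space. Nondegeneracy makes that vector zero, and
  \<open>args\<close> recovers the coefficients.\<close>

lemma det_blocks_nonzero:
  assumes q: "q \<in> \<Sigma>" and nd: "nondegenerate_at mrugala \<Sigma> q"
  shows "det (blocks (args I q)) \<noteq> 0"
proof -
  have "a = 0" if "blocks (args I q) *v a = 0" for a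
  proof -
    define u where "u = (\<Sum>k\<in>UNIV. a $ k *\<^sub>R Y k q)"
    have "u \<in> orthogonal_space mrugala \<Sigma> q"
      unfolding orthogonal_iff[OF q] u_def mrugala_Y_combination[OF q] that by simp
    then have "\<forall>v\<in>tangent_space \<Sigma> q. mrugala q u v = 0"
      by (simp add: orthogonal_space_def mrugala_commute)
    moreover have "u \<in> tangent_space \<Sigma> q"
      unfolding u_def tangent_space_eq[OF q] by (rule rangeI)
    ultimately have "u = 0" using nd by (simp add: nondegenerate_at_def)
    then have "args I u = 0" by simp
    then show "a = 0" by (simp add: u_def sum_axis_scaleR)
  qed
  then show ?thesis
    using matrix_left_invertible_ker invertible_left_inverse invertible_det_nz by blast
qed

end

section \<open>Inverting the diagonal blocks of the Hessian\<close>

lemma matrix_inv_mult: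
  fixes A :: "real ^ 'n ^ 'n"
  assumes "det A \<noteq> 0"
  shows "A ** matrix_inv A = mat 1" "matrix_inv A ** A = mat 1"
proof -
  have "\<exists>B. A ** B = mat 1 \<and> B ** A = mat 1"
    using assms unfolding invertible_det_nz[symmetric] invertible_def .
  then have "A ** matrix_inv A = mat 1 \<and> matrix_inv A ** A = mat 1"
    unfolding matrix_inv_def by (rule someI_ex)
  then show "A ** matrix_inv A = mat 1" "matrix_inv A ** A = mat 1" by blast+
qed

text \<open>On the block, C = C (H B) = (C H) B = B, and outside it both vanish; so the definite
  description in \<open>block_inverse\<close> has a unique solution.\<close>

lemma block_inverse_eqI:
  assumes 0: "\<And>k l. k \<notin> A \<or> l \<notin> A \<Longrightarrow> B $ k $ l = 0"
    and r: "\<And>k l. k \<in> A \<Longrightarrow> l \<in> A \<Longrightarrow> (\<Sum>m\<in>A. H $ k $ m * B $ m $ l) = (if k = l then 1 else 0)"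
    and l: "\<And>k l. k \<in> A \<Longrightarrow> l \<in> A \<Longrightarrow> (\<Sum>m\<in>A. B $ k $ m * H $ m $ l) = (if k = l then 1 else 0)"
  shows "block_inverse A H = B"
  unfolding block_inverse_def
proof (rule the_equality)
  fix C
  assume C: "(\<forall>k l. k \<notin> A \<or> l \<notin> A \<longrightarrow> C $ k $ l = 0) \<and>
     (\<forall>k\<in>A. \<forall>l\<in>A. (\<Sum>m\<in>A. H $ k $ m * C $ m $ l) = (if k = l then 1 else 0)) \<and>
     (\<forall>k\<in>A. \<forall>l\<in>A. (\<Sum>m\<in>A. C $ k $ m * H $ m $ l) = (if k = l then 1 else 0))"
  have "C $ i $ j = B $ i $ j" if "i \<in> A" "j \<in> A" for i j
  proof -
    have "C $ i $ j = (\<Sum>m\<in>A. C $ i $ m * (\<Sum>n\<in>A. H $ m $ n * B $ n $ j))"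
      using that r by (simp add: if_distrib[of "\<lambda>x. _ * x"] cong: if_cong)
    also have "\<dots> = (\<Sum>n\<in>A. (\<Sum>m\<in>A. C $ i $ m * H $ m $ n) * B $ n $ j)"
      unfolding sum_distrib_left sum_distrib_right by (subst sum.swap) (simp add: mult.assoc)
    also have "\<dots> = (\<Sum>n\<in>A. (if i = n then 1 else 0) * B $ n $ j)"
      using C that by (intro sum.cong) auto
    also have "\<dots> = B $ i $ j"
      using that by (simp add: if_distrib[of "\<lambda>x. x * _"] cong: if_cong)
    finally show ?thesis .
  qed
  then have "C $ i $ j = B $ i $ j" for i j
    using C 0 by (cases "i \<in> A \<and> j \<in> A") auto
  then show "C = B" by (simp add: vec_eq_iff)
qed (use assms in auto)

context generating_function
begin

text \<open>The inverse of a block-diagonal matrix is block-diagonal, with the inverses of the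
  blocks as its blocks.\<close>

lemma phi_inv_eq:
  assumes d: "det (blocks (args I z)) \<noteq> 0"
  shows "phi_inv I J \<phi> k l z = matrix_inv (blocks (args I z)) $ k $ l"
proof -
  define M where "M = blocks (args I z)"
  define B where "B = matrix_inv M"
  have B: "M ** B = mat 1" "B ** M = mat 1"
    using matrix_inv_mult[of M] d by (simp_all add: B_def M_def)
  \<comment> \<open>Masking the mixed entries of \<open>B\<close> still leaves a right inverse of
    \<open>M\<close>, because \<open>M\<close> couples no mixed indices; uniqueness of the inverse
    then shows that \<open>B\<close> has no mixed entries.\<close>
  define B' where "B' = (\<chi> i j. if (i \<in> I) = (j \<in> I) then B $ i $ j else 0)"
  have "M ** B' = mat 1"
  proof -
    have "(\<Sum>m\<in>UNIV. M $ i $ m * B' $ m $ j) = (if i = j then 1 else 0)" for i j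
    proof (cases "(i \<in> I) = (j \<in> I)")
      case True
      then have "(\<Sum>m\<in>UNIV. M $ i $ m * B' $ m $ j) = (\<Sum>m\<in>UNIV. M $ i $ m * B $ m $ j)"
        by (intro sum.cong) (auto simp: M_def blocks_def B'_def)
      then show ?thesis
        using B(1) by (simp add: vec_eq_iff matrix_matrix_mult_def mat_def)
    next
      case False
      then have "(\<Sum>m\<in>UNIV. M $ i $ m * B' $ m $ j) = 0"
        by (intro sum.neutral) (auto simp: M_def blocks_def B'_def)
      then show ?thesis using False by auto
    qed
    then show ?thesis by (simp add: vec_eq_iff matrix_matrix_mult_def mat_def)
  qed
  then have "B ** (M ** B') = B" by simp
  then have "B' = B" by (simp add: matrix_mul_assoc B)
  have off: "B $ i $ j = 0" if "(i \<in> I) \<noteq> (j \<in> I)" for i j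
    unfolding \<open>B' = B\<close>[symmetric] using that by (simp add: B'_def)
  have blk: "block_inverse A (H (args I z)) $ i $ j = B $ i $ j"
    if A: "A = I \<or> A = J" and ij: "i \<in> A" "j \<in> A" for A i j
  proof -
    \<comment> \<open>Terms outside \<open>A\<close> vanish because \<open>M\<close> and
      \<open>B\<close> couple only indices of the same type, so the block sums become entries of
      full matrix products.\<close>
    have *: "(\<Sum>m\<in>A. f m) = (\<Sum>m\<in>UNIV. g m)"
      if "\<And>m. m \<in> A \<Longrightarrow> f m = g m" "\<And>m. m \<notin> A \<Longrightarrow> g m = 0" for f g :: "'n \<Rightarrow> real"
      using that by (intro sum.mono_neutral_cong_left) auto
    have same: "(a \<in> I) = (b \<in> I)" if "a \<in> A" "b \<in> A" for a b
      using A that J_iff by blast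
    have diff: "(a \<in> I) \<noteq> (b \<in> I)" if "a \<in> A" "b \<notin> A" for a b
      using A that J_iff by blast
    have M_in: "M $ a $ b = H (args I z) $ a $ b" if "a \<in> A" "b \<in> A" for a b
      using same[OF that] by (simp add: M_def blocks_def)
    have M_out: "M $ a $ b = 0" if "a \<in> A" "b \<notin> A" for a b
      using diff[OF that] by (simp add: M_def blocks_def)
    have B_out: "B $ a $ b = 0" if "a \<in> A" "b \<notin> A" for a b
      using diff[OF that] by (rule off)
    have "block_inverse A (H (args I z)) = (\<chi> i j. if i \<in> A \<and> j \<in> A then B $ i $ j else 0)"
    proof (rule block_inverse_eqI)
      fix i j assume ij: "i \<in> A" "j \<in> A"
      have "(\<Sum>m\<in>A. H (args I z) $ i $ m * (\<chi> i j. if i \<in> A \<and> j \<in> A then B $ i $ j else 0) $ m $ j) =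
          (\<Sum>m\<in>UNIV. M $ i $ m * B $ m $ j)"
        using ij by (intro *) (simp_all add: M_in M_out)
      then show "(\<Sum>m\<in>A. H (args I z) $ i $ m * (\<chi> i j. if i \<in> A \<and> j \<in> A then B $ i $ j else 0) $ m $ j) =
          (if i = j then 1 else 0)"
        using B(1) by (simp add: vec_eq_iff matrix_matrix_mult_def mat_def)
      have "(\<Sum>m\<in>A. (\<chi> i j. if i \<in> A \<and> j \<in> A then B $ i $ j else 0) $ i $ m * H (args I z) $ m $ j) =
          (\<Sum>m\<in>UNIV. B $ i $ m * M $ m $ j)"
        using ij by (intro *) (simp_all add: M_in B_out)
      then show "(\<Sum>m\<in>A. (\<chi> i j. if i \<in> A \<and> j \<in> A then B $ i $ j else 0) $ i $ m * H (args I z) $ m $ j) =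
          (if i = j then 1 else 0)"
        using B(2) by (simp add: vec_eq_iff matrix_matrix_mult_def mat_def)
    qed auto
    then show ?thesis using ij by simp
  qed
  have "phi_inv I J \<phi> k l z = B $ k $ l"
  proof (cases "k \<in> I"; cases "l \<in> I")
    assume "k \<in> I" "l \<in> I"
    then show ?thesis using blk[of I k l] by (simp add: phi_inv_def)
  next
    assume "k \<notin> I" "l \<notin> I"
    then show ?thesis using blk[of J k l] by (simp add: phi_inv_def J_iff)
  qed (simp_all add: phi_inv_def J_iff off)
  then show ?thesis by (simp only: B_def M_def)
qed

text \<open>Cramer's rule, which exhibits the inverse of the blocks as a smooth function.\<close>

lemma phi_inv_cramer:
  assumes d: "det (blocks (args I z)) \<noteq> 0"
  shows "phi_inv I J \<phi> k l z =
    det (\<chi> i j. if j = k then axis l 1 $ i else blocks (args I z) $ i $ j) * inverse (det (blocks (args I z)))"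
proof -
  define M where "M = blocks (args I z)"
  have "M ** matrix_inv M = mat 1"
    using d by (simp add: M_def matrix_inv_mult)
  then have "M *v (\<chi> k. matrix_inv M $ k $ l) = axis l 1"
    by (simp add: vec_eq_iff matrix_matrix_mult_def matrix_vector_mult_def mat_def axis_def)
  then have "(\<chi> k. matrix_inv M $ k $ l) =
      (\<chi> k. det (\<chi> i j. if j = k then axis l 1 $ i else M $ i $ j) / det M)"
    using d cramer[of M] by (simp add: M_def)
  then show ?thesis
    unfolding phi_inv_eq[OF d] M_def[symmetric] by (simp add: vec_eq_iff divide_inverse)
qed

lemma smooth_Z:
  assumes S: "open S" "\<And>z. z \<in> S \<Longrightarrow> args I z \<in> U" "\<And>z. z \<in> S \<Longrightarrow> det (blocks (args I z)) \<noteq> 0"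
  shows "smooth_on S (Z k)"
proof -
  have b: "smooth_on S (\<lambda>z. blocks (args I z) $ i $ j)" for i j
    using smooth_compose_args[OF smooth_hessian S(1,2), of i j]
    by (cases "(i \<in> I) = (j \<in> I)") (simp_all add: blocks_def)
  have "smooth_on S (\<lambda>z. det (\<chi> i j. if j = k then axis l 1 $ i else blocks (args I z) $ i $ j) *
      inverse (det (blocks (args I z))))" for k l
  proof (intro smooth_on_mult smooth_on_inverse smooth_on_det S b)
    fix i j
    show "smooth_on S (\<lambda>z. (\<chi> i j. if j = k then axis l 1 $ i else blocks (args I z) $ i $ j) $ i $ j)"
      using b[of i j] by (cases "j = k") simp_all
  qed
  then have "smooth_on S (phi_inv I J \<phi> k l)" for k l
    by (subst smooth_on_cong[OF S(1)]) (auto simp: phi_inv_cramer S(3))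
  then show ?thesis
    unfolding Z_field_def[abs_def]
    by (intro smooth_on_diff smooth_on_scaleR smooth_on_sum smooth_on_const smooth_on_W smooth_Y S)
qed

section \<open>Coordinates, orthogonality and spanning of the fields \<open>Z_k\<close>\<close>

lemma args_Z: "args I (Z k z) $ m = - (1 / 2) * phi_inv I J \<phi> k m z"
proof -
  have "args I (Z k z) = - (1 / 2) *\<^sub>R (\<chi> m. phi_inv I J \<phi> k m z)"
    using sum_axis_scaleR[of "\<chi> m. phi_inv I J \<phi> k m z"] by (simp add: Z_field_def)
  then show ?thesis by simp
qed

lemma coargs_Z: "coargs I (Z k z) $ m =
    axis k 1 $ m - (1 / 2) * (\<Sum>l\<in>UNIV. phi_inv I J \<phi> k l z * H (args I z) $ l $ m)"
  by (simp add: Z_field_def)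

lemma contact_form_Z [simp]: "contact_form z (Z k z) = 0"
  by (simp add: Z_field_def)

lemma phi_inv_blocks:
  assumes "det (blocks (args I z)) \<noteq> 0"
  shows "(\<Sum>l\<in>UNIV. phi_inv I J \<phi> k l z * blocks (args I z) $ l $ m) = (if k = m then 1 else 0)"
  using matrix_inv_mult(2)[OF assms]
  by (simp add: phi_inv_eq[OF assms] vec_eq_iff matrix_matrix_mult_def mat_def)

text \<open>G(Y_m, W_k) is \<delta>_km times the sign of m, while G(Y_m, Y_l) is the entry of
  \<open>blocks\<close> times twice that sign. Hence half the inverse of the blocks is the
  correction that makes \<open>W_k\<close> orthogonal to every \<open>Y_m\<close>.\<close>

lemma Z_orthogonal:
  assumes q: "q \<in> \<Sigma>" and d: "det (blocks (args I q)) \<noteq> 0"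
  shows "Z k q \<in> orthogonal_space mrugala \<Sigma> q"
  unfolding orthogonal_iff[OF q]
proof
  fix m
  note sym = hessian_sym[OF args_in_U[OF q], of m]
  have "mrugala q (Y m q) (Z k q) = sgn_of I m * axis k 1 $ m -
      (1 / 2) * (\<Sum>l\<in>UNIV. phi_inv I J \<phi> k l q * ((sgn_of I l + sgn_of I m) * H (args I q) $ l $ m))"
    by (subst mrugala_Y)
      (simp_all add: args_Z coargs_Z sym sum_distrib_left algebra_simps sum.distrib sum_negf sum_subtractf
        flip: sum_divide_distrib)
  also have "\<dots> = sgn_of I m * axis k 1 $ m -
      sgn_of I m * (\<Sum>l\<in>UNIV. phi_inv I J \<phi> k l q * blocks (args I q) $ l $ m)"
    unfolding sgn_hessian by (simp add: sum_distrib_left mult_ac)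
  also have "\<dots> = 0"
    using phi_inv_blocks[OF d] by (simp add: axis_def)
  finally show "mrugala q (Y m q) (Z k q) = 0" .
qed

lemma frame_Z:
  "frame_on {q \<in> \<Sigma>. nondegenerate_at mrugala \<Sigma> q}
    (\<lambda>q. contact_dist q \<inter> orthogonal_space mrugala \<Sigma> q) Z"
  unfolding frame_on_def
proof (intro conjI allI ballI)
  fix k
  \<comment> \<open>The blocks are invertible on \<open>N\<close>, which contains the arguments of
    all nondegenerate points; the fields \<open>Z k\<close> are smooth on its preimage.\<close>
  define N where "N = {u \<in> U. det (blocks u) \<noteq> 0}"
  have "smooth_on U (\<lambda>u. blocks u $ i $ j)" for i j
    using smooth_hessian[of i j] by (cases "(i \<in> I) = (j \<in> I)") (simp_all add: blocks_def)
  then have "continuous_on U (\<lambda>u. det (blocks u))"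
    by (intro smooth_on_continuous_on smooth_on_det open_U)
  then have "open (U \<inter> (\<lambda>u. det (blocks u)) -` (- {0}))"
    by (rule continuous_open_preimage[OF _ open_U]) (simp add: open_Compl)
  also have "U \<inter> (\<lambda>u. det (blocks u)) -` (- {0}) = N"
    by (auto simp: N_def)
  finally have "open N" .
  then have "open {z. args I z \<in> N}" by (rule open_args_vimage)
  then show "smooth_field_along {q \<in> \<Sigma>. nondegenerate_at mrugala \<Sigma> q} (Z k)"
    unfolding smooth_field_along_def
    by (intro ballI exI[of _ "{z. args I z \<in> N}"] exI[of _ "Z k"])
      (auto simp: N_def args_in_U det_blocks_nonzero intro: smooth_Z)
next
  fix q assume "q \<in> {q \<in> \<Sigma>. nondegenerate_at mrugala \<Sigma> q}"
  then have q: "q \<in> \<Sigma>" and d: "det (blocks (args I q)) \<noteq> 0"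
    using det_blocks_nonzero by auto
  \<comment> \<open>\<open>args I (Z k q)\<close> is -1/2 times row k of the inverse of the
    symmetric matrix of blocks, so this map is dual to the \<open>Z k q\<close>.\<close>
  define L where "L = (\<lambda>v. - 2 *\<^sub>R (blocks (args I q) *v args I v))"
  have lin: "linear L"
    unfolding L_def
    by (rule linearI) (simp_all add: matrix_vector_right_distrib scaleR_right_distrib matrix_vector_mult_scaleR)
  have dual: "L (Z k q) = axis k 1" for k
  proof -
    have "(blocks (args I q) *v args I (Z k q)) $ m =
        - (1 / 2) * (\<Sum>l\<in>UNIV. phi_inv I J \<phi> k l q * blocks (args I q) $ l $ m)" for m
      using blocks_sym[OF args_in_U[OF q], of m]
      by (simp add: matrix_vector_mult_def args_Z sum_distrib_left mult_ac sum_negf)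
    then show ?thesis
      unfolding phi_inv_blocks[OF d] by (simp add: L_def vec_eq_iff axis_def)
  qed
  show "inj (\<lambda>k. Z k q)" "independent (range (\<lambda>k. Z k q))"
    by (rule independent_range_if_dual[OF lin dual])+
  let ?E = "contact_dist q \<inter> orthogonal_space mrugala \<Sigma> q"
  have sub: "subspace ?E"
    by (simp add: subspace_def contact_dist_def orthogonal_space_def
        linear_rules[OF linear_mrugala_right])
  have Z_in: "Z k q \<in> ?E" for k
    using Z_orthogonal[OF q d] by (simp add: contact_dist_def)
  show "span (range (\<lambda>k. Z k q)) = ?E"
  proof
    show "span (range (\<lambda>k. Z k q)) \<subseteq> ?E"
      using Z_in by (intro span_minimal sub) auto
    show "?E \<subseteq> span (range (\<lambda>k. Z k q))"
    proof
      fix v assume v: "v \<in> ?E"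
      \<comment> \<open>By duality \<open>L w = 0\<close>, hence \<open>args I w = 0\<close>.
        Orthogonality to the \<open>Y_m\<close> then reduces to the vanishing of
        \<open>coargs I w\<close>, and theta(w) = 0 as well, so \<open>w = 0\<close>.\<close>
      define w where "w = v - (\<Sum>k\<in>UNIV. L v $ k *\<^sub>R Z k q)"
      have "L w = 0"
        by (simp add: w_def linear_diff[OF lin] linear_sum[OF lin] linear_cmul[OF lin] dual sum_axis_scaleR)
      then have "blocks (args I q) *v args I w = 0" by (simp add: L_def)
      then have aw: "args I w = 0"
        using d by (metis invertible_det_nz invertible_left_inverse matrix_left_invertible_ker)
      have "w \<in> ?E"
        unfolding w_def by (intro subspace_diff[OF sub] v subspace_sum[OF sub] subspace_scale[OF sub] Z_in)
      then have cw: "contact_form q w = 0" and "\<And>m. mrugala q (Y m q) w = 0"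
        using orthogonal_iff[OF q] by (auto simp: contact_dist_def)
      then have "sgn_of I m * coargs I w $ m = 0" for m
        using mrugala_Y[OF cw, of m] aw by simp
      moreover have "sgn_of I m \<noteq> 0" for m
        by (simp add: sgn_of_def)
      ultimately have "coargs I w = 0"
        by (simp add: vec_eq_iff)
      then have "w = 0"
        using phase_eqI[of I w 0 q] aw cw by simp
      then have "v = (\<Sum>k\<in>UNIV. L v $ k *\<^sub>R Z k q)" by (simp add: w_def)
      then show "v \<in> span (range (\<lambda>k. Z k q))"
        unfolding span_range_eq by (rule range_eqI)
    qed
  qed
qed

section \<open>The second fundamental form\<close>

text \<open>Since \<open>Y k q\<close> is tangent to the graph, the derivative of \<open>g\<close>
  in its direction is determined by the values of \<open>g\<close> on the graph near
  \<open>q\<close>, and these pull back under \<open>F\<close> to \<open>h\<close>.\<close>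

lemma derivative_along_Y:
  assumes q: "q \<in> \<Sigma>" "q \<in> W" "open W" and g: "(g has_derivative g') (at q)"
    and h: "(h has_derivative h') (at (args I q))" and gh: "\<And>z. z \<in> \<Sigma> \<inter> W \<Longrightarrow> g z = h (args I z)"
  shows "g' (Y k q) = h' (axis k 1)"
proof -
  define u where "u = args I q"
  have u: "u \<in> U" "F u = q" using args_in_U param_args q by (simp_all add: u_def)
  have "((\<lambda>u. g (F u)) has_derivative (\<lambda>a. g' (\<Sum>k\<in>UNIV. a $ k *\<^sub>R Y k q))) (at u)"
    using has_derivative_compose[OF has_derivative_param[OF u(1)], of g g'] g u(2) by simp
  moreover have "open (U \<inter> F -` W)"
    by (rule continuous_open_preimage[OF smooth_on_continuous_on[OF smooth_param] open_U q(3)])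
  moreover have "u \<in> U \<inter> F -` W" using u q by simp
  moreover have "g (F u') = h u'" if "u' \<in> U \<inter> F -` W" for u'
    using gh[of "F u'"] that by (simp add: graph_eq)
  ultimately have "(h has_derivative (\<lambda>a. g' (\<Sum>k\<in>UNIV. a $ k *\<^sub>R Y k q))) (at u)"
    by (rule has_derivative_transform_within_open)
  then have "h' = (\<lambda>a. g' (\<Sum>k\<in>UNIV. a $ k *\<^sub>R Y k q))"
    by (rule has_derivative_unique[OF h[folded u_def]])
  moreover have "(\<Sum>l\<in>UNIV. (axis k 1 :: real ^ 'n) $ l *\<^sub>R Y l q) = Y k q"
    by (simp add: axis_def if_distrib[of "\<lambda>x. x *\<^sub>R _"] cong: if_cong)
  ultimately show ?thesis by simp
qed

text \<open>d theta vanishes on the tangent spaces; in the frame \<open>Y\<close> this is the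
  symmetry of the Hessian.\<close>

lemma pairing_Y_commute:
  assumes "q \<in> \<Sigma>"
  shows "pairing (Y k q) (Y l q) = pairing (Y l q) (Y k q)"
proof -
  have "pairing (Y k q) (Y l q) - pairing (Y l q) (Y k q) = H (args I q) $ l $ k - H (args I q) $ k $ l"
    unfolding pairing_diff_commute[of _ _ I]
    by (simp add: sum_subtractf axis_def if_distrib[of "\<lambda>x. x * _"] if_distrib[of "\<lambda>x. _ * x"] cong: if_cong)
  then show ?thesis using hessian_sym[OF args_in_U[OF assms]] by simp
qed

text \<open>For arbitrary extensions \<open>A\<close> and \<open>B\<close> only the values on the
  graph enter, since every derivative is taken along the tangent vector
  \<open>Y k q\<close>.\<close>

lemma nabla_Y:
  assumes W: "open W" and LC: "levi_civita_on W mrugala nabla"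
    and A: "smooth_on W A" "\<And>z. z \<in> \<Sigma> \<inter> W \<Longrightarrow> A z = Y k z"
    and B: "smooth_on W B" "\<And>z. z \<in> \<Sigma> \<inter> W \<Longrightarrow> B z = Y l z"
    and q: "q \<in> \<Sigma> \<inter> W"
  shows "nabla A B q = (\<Sum>s\<in>UNIV. phi3 I \<phi> l k s q *\<^sub>R W_field I s q)"
proof -
  define D where "D = frechet_derivative B (at q)"
  have q': "q \<in> \<Sigma>" "q \<in> W" using q by auto
  have D: "(B has_derivative D) (at q)"
    unfolding D_def by (rule smooth_on_has_derivative[OF B(1) q'(2)])
  have Aq: "A q = Y k q" and Bq: "B q = Y l q" using A(2) B(2) q by auto
  note along = derivative_along_Y[OF q' W]
  \<comment> \<open>Along the graph the three coordinates of \<open>B\<close> are the constant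
    \<open>axis l 1\<close>, row \<open>l\<close> of the Hessian, and 0; differentiating them along
    \<open>Y_k\<close> gives \<open>args\<close>, \<open>coargs\<close> and
    \<open>contact\<close>.\<close>
  have args: "args I (D (Y k q)) = 0"
    by (rule along[OF bounded_linear.has_derivative[OF bounded_linear_args D]
          has_derivative_const[of "axis l 1"]]) (simp add: B(2))
  have dH: "((\<lambda>u. H u $ l $ s) has_derivative frechet_derivative (\<lambda>u. H u $ l $ s) (at (args I q)))
      (at (args I q))" for s
    by (rule smooth_on_has_derivative[OF smooth_hessian args_in_U[OF q'(1)]])
  have phi3: "phi3 I \<phi> l k s q = frechet_derivative (\<lambda>u. H u $ l $ s) (at (args I q)) (axis k 1)" for s
  proof -
    have "((\<lambda>z. H (args I z) $ l $ s) has_derivative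
        (\<lambda>v. frechet_derivative (\<lambda>u. H u $ l $ s) (at (args I q)) (args I v))) (at q)"
      by (rule has_derivative_compose[OF bounded_linear_imp_has_derivative[OF bounded_linear_args] dH])
    from frechet_derivative_eqI[OF this] show ?thesis
      by (simp add: phi3_def deriv_along_def)
  qed
  have coargs: "coargs I (D (Y k q)) $ s = phi3 I \<phi> l k s q" for s
    unfolding phi3
    by (rule along[OF bounded_linear.has_derivative[OF bounded_linear_vec_nth
          bounded_linear.has_derivative[OF bounded_linear_coargs D]] dH]) (simp add: B(2))
  have contact: "contact_form q (D (Y k q)) + pairing (Y k q) (Y l q) = 0"
    unfolding Bq[symmetric]
    by (rule along[OF has_derivative_contact_form[OF D] has_derivative_const[of 0]]) (simp add: B(2))
  have nabla: "nabla A B q = D (Y k q) +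
      ((pairing (Y k q) (Y l q) + pairing (Y l q) (Y k q)) / 2, 0, 0)"
    using levi_civita_mrugala[OF LC A(1) B(1) q'(2)] by (simp add: Aq Bq deriv_along_def D_def)
  have reeb: "args I (r, 0, 0) = (0 :: real ^ 'n)" "coargs I (r, 0, 0) = (0 :: real ^ 'n)"
    "contact_form q (r, 0, 0) = r" for r
    by (simp_all add: args_def coargs_def contact_form_def dx0_def dx_def p_of_def x_of_def vec_eq_iff)
  show ?thesis
  proof (rule phase_eqI)
    show "args I (nabla A B q) = args I (\<Sum>s\<in>UNIV. phi3 I \<phi> l k s q *\<^sub>R W_field I s q)"
      by (simp add: nabla args reeb)
    show "coargs I (nabla A B q) = coargs I (\<Sum>s\<in>UNIV. phi3 I \<phi> l k s q *\<^sub>R W_field I s q)"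
      using sum_axis_scaleR[of "\<chi> s. phi3 I \<phi> l k s q"]
      by (simp add: nabla reeb) (simp add: vec_eq_iff coargs)
    \<comment> \<open>By symmetry the connection's correction equals
      \<open>pairing (Y k q) (Y l q)\<close>, which cancels the theta component of
      \<open>D (Y k q)\<close>.\<close>
    show "contact_form q (nabla A B q) = contact_form q (\<Sum>s\<in>UNIV. phi3 I \<phi> l k s q *\<^sub>R W_field I s q)"
      using contact pairing_Y_commute[OF q'(1), of l k] by (simp add: nabla reeb)
  qed
qed

text \<open>Two candidates differ by a vector that is both tangent and normal, hence zero by
  nondegeneracy; this gives the uniqueness behind the definite description.\<close>

lemma normal_projection_eqI:
  assumes q: "q \<in> \<Sigma>" and nd: "nondegenerate_at mrugala \<Sigma> q"
    and w: "w \<in> orthogonal_space mrugala \<Sigma> q" and vw: "v - w \<in> tangent_space \<Sigma> q"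
  shows "normal_projection mrugala \<Sigma> q v = w"
  unfolding normal_projection_def
proof (rule the_equality)
  fix w' assume w': "w' \<in> orthogonal_space mrugala \<Sigma> q \<and> v - w' \<in> tangent_space \<Sigma> q"
  have T: "subspace (tangent_space \<Sigma> q)"
    using frame_Y q unfolding frame_on_def by (metis subspace_span)
  have "(v - w) - (v - w') \<in> tangent_space \<Sigma> q"
    using subspace_diff[OF T vw] w' by blast
  then have "w' - w \<in> tangent_space \<Sigma> q" by simp
  moreover have "mrugala q (w' - w) u = 0" if "u \<in> tangent_space \<Sigma> q" for u
    unfolding mrugala_commute[of q "w' - w"]
    using w w' that by (simp add: orthogonal_space_def linear_diff[OF linear_mrugala_right])
  ultimately have "w' - w = 0"
    using nd unfolding nondegenerate_at_def by blast
  then show "w' = w" by simp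
qed (use w vw in auto)

lemma second_fundamental_form_Y:
  assumes "open W" "levi_civita_on W mrugala nabla"
    and "smooth_on W A" "\<And>z. z \<in> \<Sigma> \<inter> W \<Longrightarrow> A z = Y k z"
    and "smooth_on W B" "\<And>z. z \<in> \<Sigma> \<inter> W \<Longrightarrow> B z = Y l z"
    and q: "q \<in> \<Sigma> \<inter> W" and nd: "nondegenerate_at mrugala \<Sigma> q"
  shows "second_fundamental_form mrugala \<Sigma> nabla A B q = (\<Sum>s\<in>UNIV. phi3 I \<phi> l k s q *\<^sub>R Z s q)"
proof -
  have nabla: "nabla A B q = (\<Sum>s\<in>UNIV. phi3 I \<phi> l k s q *\<^sub>R W_field I s q)"
    by (rule nabla_Y[OF assms(1,2,3) _ assms(5) _ q]) (rule assms(4,6), assumption)+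
  show ?thesis
    unfolding second_fundamental_form_def nabla
  proof (rule normal_projection_eqI[OF _ nd])
    show q': "q \<in> \<Sigma>" using q by simp
    note lin = linear_sum[OF linear_mrugala_right] linear_cmul[OF linear_mrugala_right]
    show "(\<Sum>s\<in>UNIV. phi3 I \<phi> l k s q *\<^sub>R Z s q) \<in> orthogonal_space mrugala \<Sigma> q"
      using Z_orthogonal[OF q' det_blocks_nonzero[OF q' nd]]
      by (simp add: orthogonal_space_def lin)
    \<comment> \<open>\<open>Z_s\<close> arises from \<open>W_s\<close> by subtracting half of a
      combination of the \<open>Y_m\<close>, so the difference lies in their span, the tangent
      space.\<close>
    have "(\<Sum>s\<in>UNIV. phi3 I \<phi> l k s q *\<^sub>R W_field I s q) - (\<Sum>s\<in>UNIV. phi3 I \<phi> l k s q *\<^sub>R Z s q) =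
        (\<Sum>s\<in>UNIV. phi3 I \<phi> l k s q *\<^sub>R (1 / 2) *\<^sub>R (\<Sum>m\<in>UNIV. phi_inv I J \<phi> s m q *\<^sub>R Y m q))"
      by (simp add: Z_field_def scaleR_diff_right sum_subtractf)
    also have "\<dots> \<in> span (range (\<lambda>k. Y k q))"
      by (intro span_sum span_scale span_base rangeI)
    finally have "(\<Sum>s\<in>UNIV. phi3 I \<phi> l k s q *\<^sub>R W_field I s q) -
        (\<Sum>s\<in>UNIV. phi3 I \<phi> l k s q *\<^sub>R Z s q) \<in> span (range (\<lambda>k. Y k q))" .
    then show "(\<Sum>s\<in>UNIV. phi3 I \<phi> l k s q *\<^sub>R W_field I s q) - (\<Sum>s\<in>UNIV. phi3 I \<phi> l k s q *\<^sub>R Z s q) \<in>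
        tangent_space \<Sigma> q"
      using frame_Y q' by (simp add: frame_on_def)
  qed
qed

end

theorem proposition3:
  fixes I J :: "'n::finite set"
    and U :: "(real ^ 'n) set"
    and \<phi> :: "real ^ 'n \<Rightarrow> real"
    and \<Sigma> :: "'n phase set"
  assumes "I \<union> J = UNIV" and "I \<inter> J = {}"
    and "open U" and "smooth_on U \<phi>"
    and "\<Sigma> = legendre_graph I J U \<phi>"
  shows "legendre_submanifold \<Sigma> \<and>
    frame_on \<Sigma> (tangent_space \<Sigma>) (Y_field I \<phi>) \<and>
    frame_on {q \<in> \<Sigma>. nondegenerate_at mrugala \<Sigma> q}
      (\<lambda>q. contact_dist q \<inter> orthogonal_space mrugala \<Sigma> q) (Z_field I J \<phi>) \<and>
    (\<forall>W nabla X Y k l q.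
       open W \<longrightarrow> levi_civita_on W mrugala nabla \<longrightarrow>
       smooth_on W X \<longrightarrow> (\<forall>z\<in>\<Sigma> \<inter> W. X z = Y_field I \<phi> k z) \<longrightarrow>
       smooth_on W Y \<longrightarrow> (\<forall>z\<in>\<Sigma> \<inter> W. Y z = Y_field I \<phi> l z) \<longrightarrow>
       q \<in> \<Sigma> \<inter> W \<longrightarrow> nondegenerate_at mrugala \<Sigma> q \<longrightarrow>
       second_fundamental_form mrugala \<Sigma> nabla X Y q =
         (\<Sum>s\<in>UNIV. phi3 I \<phi> l k s q *\<^sub>R Z_field I J \<phi> s q))"
proof -
  interpret generating_function I J U \<phi>
    using assms by unfold_locales
  show ?thesis
    unfolding assms(5)
  proof (intro conjI allI impI)
    fix W nabla A B k l q
    assume prems: "open W" "levi_civita_on W mrugala nabla" "smooth_on W A"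
      "\<forall>z\<in>legendre_graph I J U \<phi> \<inter> W. A z = Y_field I \<phi> k z" "smooth_on W B"
      "\<forall>z\<in>legendre_graph I J U \<phi> \<inter> W. B z = Y_field I \<phi> l z"
      "q \<in> legendre_graph I J U \<phi> \<inter> W" "nondegenerate_at mrugala (legendre_graph I J U \<phi>) q"
    show "second_fundamental_form mrugala (legendre_graph I J U \<phi>) nabla A B q =
        (\<Sum>s\<in>UNIV. phi3 I \<phi> l k s q *\<^sub>R Z_field I J \<phi> s q)"
      by (rule second_fundamental_form_Y[OF prems(1,2,3) bspec[OF prems(4)] prems(5)
            bspec[OF prems(6)] prems(7,8)])
  qed (rule legendre frame_Y frame_Z)+
qed

end
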